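(* Let $n\ge 1$ and let $f(x,y,\omega)=\sum_i f_i(\omega)\,\phi(x-x_i(\omega),y-y_i(\omega))$ be the random obstacle field described in the context (satisfying the obstacle shape condition and the obstacle distribution condition stated there). Then there exist a (deterministic) constant $F^*>0$ and a non-negative function $v:\mathbb{R}^n\times\Omega\to[0,\infty)$ such that, almost surely, $$0\ \ge\ \Delta v(x,\omega)+f(x,v(x,\omega),\omega)+F^*\qquad\text{on }\mathbb{R}^n$$ (in the sense of distributions and in the sense of viscosity solutions); that is, $v$ is a non-negative stationary supersolution, so that any solution $u$ of $$\partial_t u(x,t,\omega)=\Delta u(x,t,\omega)+f(x,u(x,t,\omega),\omega)+F\quad\text{on }\mathbb{R}^n,\qquad u(x,0,\omega)=0,$$ with $F\le F^*$ gets pinned, i.e. by the parabolic comparison principle $u(x,t,\omega)\le v(x,\omega)$ for all $t\ge 0$ and $x\in\mathbb{R}^n$.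
   Context: Let $(\Omega,\mathcal{F},\mathbf{P})$ be a probability space. $\|\cdot\|$ denotes the Euclidean norm and $\|\cdot\|_\infty$ the maximum norm on $\mathbb{R}^{n+1}=\mathbb{R}^n\times\mathbb{R}$. Obstacle shape condition: $\phi\in C^\infty(\mathbb{R}^n\times\mathbb{R})$ and there exist $r_1,r_0$ with $r_1>\sqrt{n}\,r_0>0$ such that (i) $\phi\le 0$, and $\phi(x,y)=0$ whenever $\|(x,y)\|>r_1$; (ii) $\phi(x,y)\le -1$ whenever $\|(x,y)\|_\infty\le r_0$. Obstacle distribution condition: the random obstacle centers $\{(x_k,y_k)\}_{k\in\mathbb{N}}\subset\mathbb{R}^n\times[r_1,\infty)$ and strengths $\{f_k\}_{k\in\mathbb{N}}\subset[0,\infty)$ satisfy: (i) the $(x_k,y_k)$ are distributed according to an $(n+1)$-dimensional Poisson process on $\mathbb{R}^n\times[r_1,\infty)$ with intensity $\lambda>0$; (ii) the $f_k$ are i.i.d. strictly positive random variables which are independent of $\{(x_k,y_k)\}_{k}$. Solutions $u$ of the evolution equation are understood in a class for which the comparison principle for parabolic equations holds (a solution with initial condition below a stationary supersolution remains below it). *)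

theory Defs
  imports "HOL-Probability.Probability"
begin

section \<open>Smooth functions and the Laplacian\<close>

text \<open>\<open>times_cont_diff k \<psi>\<close>: \<open>\<psi>\<close> is of class \<open>C\<^sup>k\<close> on the whole space.\<close>

primrec times_cont_diff :: "nat \<Rightarrow> ('a::euclidean_space \<Rightarrow> real) \<Rightarrow> bool" where
  "times_cont_diff 0 \<psi> \<longleftrightarrow> continuous_on UNIV \<psi>"
| "times_cont_diff (Suc k) \<psi> \<longleftrightarrow>
     (\<forall>x. \<psi> differentiable (at x)) \<and>
     (\<forall>d. times_cont_diff k (\<lambda>x. frechet_derivative \<psi> (at x) d))"

definition smooth :: "('a::euclidean_space \<Rightarrow> real) \<Rightarrow> bool" where
  "smooth \<psi> \<longleftrightarrow> (\<forall>k. times_cont_diff k \<psi>)"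

definition laplacian :: "('a::euclidean_space \<Rightarrow> real) \<Rightarrow> 'a \<Rightarrow> real" where
  "laplacian \<psi> x =
     (\<Sum>b\<in>Basis. frechet_derivative (\<lambda>z. frechet_derivative \<psi> (at z) b) (at x) b)"

section \<open>Stationary supersolutions\<close>

text \<open>
  Both notions of supersolution are for the stationary inequality
  \<open>0 \<ge> \<Delta>w(x) + g(x, w(x)) + F\<close> on the whole space.
\<close>

definition locally_integrable :: "('a::euclidean_space \<Rightarrow> real) \<Rightarrow> bool" where
  "locally_integrable h \<longleftrightarrow> (\<forall>K. compact K \<longrightarrow> set_integrable lborel K h)"

definition distributional_supersolution ::
  "('a::euclidean_space \<Rightarrow> real \<Rightarrow> real) \<Rightarrow> real \<Rightarrow> ('a \<Rightarrow> real) \<Rightarrow> bool" where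
  "distributional_supersolution g F w \<longleftrightarrow>
     locally_integrable w \<and> locally_integrable (\<lambda>x. g x (w x)) \<and>
     (\<forall>\<psi>. smooth \<psi> \<and> compact (closure {x. \<psi> x \<noteq> 0}) \<and> (\<forall>x. 0 \<le> \<psi> x) \<longrightarrow>
        (LINT x|lborel. w x * laplacian \<psi> x + (g x (w x) + F) * \<psi> x) \<le> 0)"

definition lower_semicontinuous :: "('a::topological_space \<Rightarrow> real) \<Rightarrow> bool" where
  "lower_semicontinuous w \<longleftrightarrow> (\<forall>c. open {x. c < w x})"

definition viscosity_supersolution ::
  "('a::euclidean_space \<Rightarrow> real \<Rightarrow> real) \<Rightarrow> real \<Rightarrow> ('a \<Rightarrow> real) \<Rightarrow> bool" where
  "viscosity_supersolution g F w \<longleftrightarrow>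
     lower_semicontinuous w \<and>
     (\<forall>\<psi> x0. times_cont_diff 2 \<psi> \<and>
        (\<forall>\<^sub>F x in nhds x0. w x0 - \<psi> x0 \<le> w x - \<psi> x) \<longrightarrow>
        laplacian \<psi> x0 + g x0 (w x0) + F \<le> 0)"

definition stationary_supersolution ::
  "('a::euclidean_space \<Rightarrow> real \<Rightarrow> real) \<Rightarrow> real \<Rightarrow> ('a \<Rightarrow> real) \<Rightarrow> bool" where
  "stationary_supersolution g F w \<longleftrightarrow>
     distributional_supersolution g F w \<and> viscosity_supersolution g F w"

section \<open>The evolution equation and the comparison principle\<close>

text \<open>
  \<open>u x t\<close> is a continuous viscosity solution of
  \<open>\<partial>\<^sub>t u(x,t) = \<Delta>u(x,t) + g(x, u(x,t)) + F\<close> for \<open>t > 0\<close>; the initial condition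
  is imposed separately.
\<close>

definition evolution_solution ::
  "('a::euclidean_space \<Rightarrow> real \<Rightarrow> real) \<Rightarrow> real \<Rightarrow> ('a \<Rightarrow> real \<Rightarrow> real) \<Rightarrow> bool" where
  "evolution_solution g F u \<longleftrightarrow>
     continuous_on (UNIV \<times> {0..}) (\<lambda>(x, t). u x t) \<and>
     (\<forall>\<psi> x0 t0. t0 > 0 \<and> times_cont_diff 2 (\<psi> :: 'a \<times> real \<Rightarrow> real) \<and>
        (\<forall>\<^sub>F (x, t) in nhds (x0, t0). u x t - \<psi> (x, t) \<le> u x0 t0 - \<psi> (x0, t0)) \<longrightarrow>
        deriv (\<lambda>t. \<psi> (x0, t)) t0
          \<le> laplacian (\<lambda>x. \<psi> (x, t0)) x0 + g x0 (u x0 t0) + F) \<and>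
     (\<forall>\<psi> x0 t0. t0 > 0 \<and> times_cont_diff 2 (\<psi> :: 'a \<times> real \<Rightarrow> real) \<and>
        (\<forall>\<^sub>F (x, t) in nhds (x0, t0). u x0 t0 - \<psi> (x0, t0) \<le> u x t - \<psi> (x, t)) \<longrightarrow>
        deriv (\<lambda>t. \<psi> (x0, t)) t0
          \<ge> laplacian (\<lambda>x. \<psi> (x, t0)) x0 + g x0 (u x0 t0) + F)"

text \<open>
  On an unbounded domain, and with obstacle strengths that are not bounded, comparison
  can only be expected within a suitable class of functions (growth at infinity, say).
  \<open>comparison_class g F U\<close> says that \<open>U\<close> is such a class.
\<close>

definition comparison_class ::
  "('a::euclidean_space \<Rightarrow> real \<Rightarrow> real) \<Rightarrow> real \<Rightarrow> ('a \<Rightarrow> real \<Rightarrow> real) set \<Rightarrow> bool" where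
  "comparison_class g F U \<longleftrightarrow>
     (\<forall>u\<in>U. \<forall>w. evolution_solution g F u \<and> stationary_supersolution g F w \<and>
        (\<forall>x. u x 0 \<le> w x) \<longrightarrow> (\<forall>x. \<forall>t\<ge>0. u x t \<le> w x))"

section \<open>The random obstacle field\<close>

text \<open>
  The norm of the product type is the Euclidean norm of \<open>\<real>\<^sup>n \<times> \<real>\<close>, and
  \<^const>\<open>infnorm\<close> is its maximum norm.
\<close>

definition obstacle_shape ::
  "((real ^ 'n) \<times> real \<Rightarrow> real) \<Rightarrow> real \<Rightarrow> real \<Rightarrow> bool" where
  "obstacle_shape \<phi> r0 r1 \<longleftrightarrow>
     smooth \<phi> \<and>
     r1 > sqrt (real CARD('n)) * r0 \<and> sqrt (real CARD('n)) * r0 > 0 \<and>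
     (\<forall>z. \<phi> z \<le> 0) \<and> (\<forall>z. norm z > r1 \<longrightarrow> \<phi> z = 0) \<and>
     (\<forall>z. infnorm z \<le> r0 \<longrightarrow> \<phi> z \<le> -1)"

text \<open>
  Number of points of the random sequence \<open>X\<close> in \<open>A\<close>, counted with multiplicity and
  equal to \<open>\<infinity>\<close> if there are infinitely many.
\<close>

definition point_count :: "(nat \<Rightarrow> 'w \<Rightarrow> 'b) \<Rightarrow> 'b set \<Rightarrow> 'w \<Rightarrow> ennreal" where
  "point_count X A \<omega> = emeasure (count_space UNIV) {k. X k \<omega> \<in> A}"

text \<open>
  \<open>X\<close> enumerates a homogeneous Poisson process on \<open>D\<close> with intensity \<open>lam\<close>.  The Poisson
  weights are written out because \<^const>\<open>poisson_pmf\<close> is unspecified for rate \<open>0\<close>, which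
  occurs for null sets \<open>A\<close>.
\<close>

definition poisson_process ::
  "'w measure \<Rightarrow> real \<Rightarrow> 'b::euclidean_space set \<Rightarrow> (nat \<Rightarrow> 'w \<Rightarrow> 'b) \<Rightarrow> bool" where
  "poisson_process M lam D X \<longleftrightarrow>
     (\<forall>k. X k \<in> borel_measurable M) \<and>
     (\<forall>k. \<forall>\<omega>\<in>space M. X k \<omega> \<in> D) \<and>
     (\<forall>A\<in>sets borel. A \<subseteq> D \<and> emeasure lborel A < \<infinity> \<longrightarrow>
        (\<forall>m. measure M {\<omega> \<in> space M. point_count X A \<omega> = of_nat m}
           = (lam * measure lborel A) ^ m / fact m * exp (- (lam * measure lborel A)))) \<and>
     (\<forall>(m::nat) A. disjoint_family_on A {..<m} \<and>
        (\<forall>i<m. A i \<in> sets borel \<and> A i \<subseteq> D \<and> emeasure lborel (A i) < \<infinity>) \<longrightarrow>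
        prob_space.indep_vars M (\<lambda>_. borel) (\<lambda>i. point_count X (A i)) {..<m})"

text \<open>
  \<open>X k\<close> is the centre \<open>(x\<^sub>k, y\<^sub>k)\<close> and \<open>f k\<close> the strength of the \<open>k\<close>-th obstacle.  The last
  conjunct is independence of the sigma-algebras generated by the whole sequence of strengths
  and by the whole sequence of centres (which take values in different types, so that
  \<open>indep_var\<close> is not applicable).
\<close>

definition obstacle_distribution ::
  "'w measure \<Rightarrow> real \<Rightarrow> real \<Rightarrow> (nat \<Rightarrow> 'w \<Rightarrow> (real ^ 'n) \<times> real) \<Rightarrow>
   (nat \<Rightarrow> 'w \<Rightarrow> real) \<Rightarrow> bool" where
  "obstacle_distribution M lam r1 X f \<longleftrightarrow>
     lam > 0 \<and>
     poisson_process M lam (UNIV \<times> {r1..}) X \<and>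
     (\<forall>k. \<forall>\<omega>\<in>space M. 0 \<le> f k \<omega>) \<and>
     (\<forall>k. AE \<omega> in M. 0 < f k \<omega>) \<and>
     prob_space.indep_vars M (\<lambda>_. borel) f UNIV \<and>
     (\<forall>k. distr M borel (f k) = distr M borel (f 0)) \<and>
     prob_space.indep_set M
       (sets (vimage_algebra (space M) (\<lambda>\<omega> k. f k \<omega>) (PiM UNIV (\<lambda>_. borel))))
       (sets (vimage_algebra (space M) (\<lambda>\<omega> k. X k \<omega>) (PiM UNIV (\<lambda>_. borel))))"

text \<open>
  Almost surely the sum has, at every point, only finitely many non-zero terms.
\<close>

definition obstacle_field ::
  "((real ^ 'n) \<times> real \<Rightarrow> real) \<Rightarrow> (nat \<Rightarrow> 'w \<Rightarrow> (real ^ 'n) \<times> real) \<Rightarrow>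
   (nat \<Rightarrow> 'w \<Rightarrow> real) \<Rightarrow> 'w \<Rightarrow> real ^ 'n \<Rightarrow> real \<Rightarrow> real" where
  "obstacle_field \<phi> X f \<omega> x y =
     (\<Sum>\<^sub>\<infinity>i. f i \<omega> * \<phi> (x - fst (X i \<omega>), y - snd (X i \<omega>)))"

end

theory Submission
  imports Defs
begin

text \<open>
  The supersolution is a minimum of translates of one radial profile, each translate resting
  on one strong obstacle; percolation theory supplies one obstacle per column of space, at
  heights that vary slowly from column to column.

  A minimum of functions is a supersolution wherever the function that attains the minimum is
  one. In terms of second differences
  \<open>\<Sum>\<^sub>b v(x + h b) + v(x - h b) - 2 v(x)\<close>, taken over the coordinate directions \<open>b\<close>, this is
  immediate: replacing \<open>v\<close> by the translate that attains the minimum at \<open>x\<close> can only increase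
  the difference. A bound on the second differences that is uniform for small \<open>h\<close> implies the
  inequality both in the viscosity sense (a test function touching from below has smaller
  second differences) and in the distributional sense (summation by parts moves the difference
  onto the test function): \<open>second_difference_imp_viscosity\<close> and
  \<open>second_difference_imp_distributional\<close>.

  The profile is \<open>W(z) = B \<bar>z\<bar>\<^sup>2 - A (\<bar>z\<bar>\<^sup>2 + a)\<^sup>-\<^sup>s\<close> with \<open>s = n/2 - 1/4\<close>. As \<open>2 s > n - 2\<close>, the
  second term is strictly superharmonic outside the ball of radius \<open>r0\<close>; near the centre its
  Laplacian is positive, but there it is compensated by the obstacle, whose force there is at most
  \<open>- \<theta>\<close>. The first term, with a small \<open>B\<close>, makes the profile grow, so that at any point only
  translates with a nearby centre compete for the minimum.

  Centres are found as follows. Space is divided into columns of width \<open>l\<close> and the columns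
  into cells of height \<open>h\<close> with \<open>l\<^sup>n h = V\<close> fixed. If \<open>V\<close> is large, a given cell contains an
  obstacle of strength at least \<open>\<theta>\<close> with probability close to 1, and a Lipschitz percolation
  argument (\<open>AE_not_reach\<close>, \<open>lipschitz_surface\<close>) yields almost surely a function \<open>H\<close> on \<open>\<int>\<^sup>n\<close>,
  changing by at most 1 between neighbours, such that the cell at height \<open>H k\<close> over every
  column \<open>k\<close> contains one. It remains to beat the height differences, of order \<open>h = V l\<^sup>-\<^sup>n\<close>
  between neighbouring columns, by the growth of the profile. Superharmonicity at
  distances of order \<open>l\<close> permits \<open>B\<close> of order \<open>l\<close> to the power \<open>- 2 s - 2\<close>, so that the growth
  over such distances has order \<open>l\<close> to the power \<open>- 2 s = 1/2 - n\<close>. This exceeds \<open>h\<close> for large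
  \<open>l\<close>, which is why \<open>2 s\<close> has to lie strictly between \<open>n - 2\<close> and \<open>n\<close>.
\<close>

section \<open>Second differences\<close>

text \<open>
  By Taylor's formula with Lagrange remainder, a symmetric second difference in direction \<open>b\<close>
  is \<open>h\<^sup>2\<close> times an average of two values of the second directional derivative; these are
  uniformly continuous near a compact set. Only derivatives along the coordinate lines are
  mentioned, so that the lemma covers both \<open>C\<^sup>2\<close> test functions and the explicit profile below.
\<close>

lemma second_difference_approx:
  fixes \<psi> :: "'a::euclidean_space \<Rightarrow> real"
  assumes D1: "\<And>z b. b \<in> Basis \<Longrightarrow> ((\<lambda>s. \<psi> (z + s *\<^sub>R b)) has_real_derivative P b z) (at 0)"
    and D2: "\<And>z b. b \<in> Basis \<Longrightarrow> ((\<lambda>s. P b (z + s *\<^sub>R b)) has_real_derivative Q b z) (at 0)"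
    and Q: "\<And>b. b \<in> Basis \<Longrightarrow> continuous_on UNIV (Q b)"
    and K: "compact K" and \<eta>: "\<eta> > 0"
  shows "\<forall>\<^sub>F h in at_right 0. \<forall>z\<in>K.
    \<bar>(\<Sum>b\<in>Basis. \<psi> (z + h *\<^sub>R b) + \<psi> (z - h *\<^sub>R b) - 2 * \<psi> z) - h\<^sup>2 * (\<Sum>b\<in>Basis. Q b z)\<bar> \<le> \<eta> * h\<^sup>2"
proof -
  define K1 where "K1 = {x + y | x y. x \<in> K \<and> y \<in> cball 0 1}"
  have cK1: "compact K1" unfolding K1_def by (rule compact_sums[OF K compact_cball])
  define d where "d = real DIM('a)"
  have d: "d > 0" unfolding d_def by simp
  have D1': "((\<lambda>s. \<psi> (z + s *\<^sub>R b)) has_real_derivative P b (z + t *\<^sub>R b)) (at t)" if "b \<in> Basis" for z b t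
    using D1[OF that, of "z + t *\<^sub>R b"] DERIV_at_within_shift[of "\<lambda>s. \<psi> (z + s *\<^sub>R b)" _ t 0 UNIV]
    by (simp add: algebra_simps)
  have D2': "((\<lambda>s. P b (z + s *\<^sub>R b)) has_real_derivative Q b (z + t *\<^sub>R b)) (at t)" if "b \<in> Basis" for z b t
    using D2[OF that, of "z + t *\<^sub>R b"] DERIV_at_within_shift[of "\<lambda>s. P b (z + s *\<^sub>R b)" _ t 0 UNIV]
    by (simp add: algebra_simps)
  have D1m: "((\<lambda>s. \<psi> (z - s *\<^sub>R b)) has_real_derivative - P b (z - t *\<^sub>R b)) (at t)" if "b \<in> Basis" for z b t
    using DERIV_chain2[OF D1'[OF that, of z "-t"] DERIV_minus[OF DERIV_ident]] by simp
  have D2m: "((\<lambda>s. P b (z - s *\<^sub>R b)) has_real_derivative - Q b (z - t *\<^sub>R b)) (at t)" if "b \<in> Basis" for z b t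
    using DERIV_chain2[OF D2'[OF that, of z "-t"] DERIV_minus[OF DERIV_ident]] by simp
  have single: "\<forall>\<^sub>F h in at_right 0. \<forall>z\<in>K.
      \<bar>\<psi> (z + h *\<^sub>R b) + \<psi> (z - h *\<^sub>R b) - 2 * \<psi> z - h\<^sup>2 * Q b z\<bar> \<le> (\<eta> / d) * h\<^sup>2"
    if b: "b \<in> Basis" for b
  proof -
    have "uniformly_continuous_on K1 (Q b)"
      using compact_uniformly_continuous[OF continuous_on_subset[OF Q[OF b]] cK1] by simp
    moreover have "\<eta> / d > 0" using \<eta> d by simp
    ultimately obtain \<delta> where \<delta>: "\<delta> > 0"
      and u: "\<And>x x'. x \<in> K1 \<Longrightarrow> x' \<in> K1 \<Longrightarrow> dist x' x < \<delta> \<Longrightarrow> dist (Q b x') (Q b x) < \<eta> / d"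
      unfolding uniformly_continuous_on_def by metis
    have "\<forall>z\<in>K. \<bar>\<psi> (z + h *\<^sub>R b) + \<psi> (z - h *\<^sub>R b) - 2 * \<psi> z - h\<^sup>2 * Q b z\<bar> \<le> (\<eta> / d) * h\<^sup>2"
      if h: "0 < h" "h < min \<delta> 1" for h
    proof
      fix z assume z: "z \<in> K"
      define D where "D m s = (if m = 0 then \<psi> (z + s *\<^sub>R b) + \<psi> (z - s *\<^sub>R b)
         else if m = 1 then P b (z + s *\<^sub>R b) - P b (z - s *\<^sub>R b) else Q b (z + s *\<^sub>R b) + Q b (z - s *\<^sub>R b))"
        for m :: nat and s
      have "\<exists>t>0. t < h \<and> D 0 h = (\<Sum>m<2. D m 0 / fact m * h ^ m) + D 2 t / fact 2 * h\<^sup>2"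
      proof (rule Maclaurin[OF h(1)])
        show "\<forall>m t. m < 2 \<and> 0 \<le> t \<and> t \<le> h \<longrightarrow> (D m has_real_derivative D (Suc m) t) (at t)"
        proof (intro allI impI)
          fix m :: nat and t assume "m < 2 \<and> 0 \<le> t \<and> t \<le> h"
          then consider "m = 0" | "m = 1" by linarith
          then show "(D m has_real_derivative D (Suc m) t) (at t)"
          proof cases
            case 1
            show ?thesis using DERIV_add[OF D1'[OF b, of z t] D1m[OF b, of z t]] 1
              by (simp add: D_def[abs_def])
          next
            case 2
            show ?thesis using DERIV_diff[OF D2'[OF b, of z t] D2m[OF b, of z t]] 2
              by (simp add: D_def[abs_def])
          qed
        qed
      qed auto
      then obtain t where t: "0 < t" "t < h"
        and e: "D 0 h = (\<Sum>m<2. D m 0 / fact m * h ^ m) + D 2 t / fact 2 * h\<^sup>2" by blast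
      have "\<psi> (z + h *\<^sub>R b) + \<psi> (z - h *\<^sub>R b) - 2 * \<psi> z = (Q b (z + t *\<^sub>R b) + Q b (z - t *\<^sub>R b)) / 2 * h\<^sup>2"
        using e by (simp add: D_def numeral_2_eq_2)
      then have eq: "\<psi> (z + h *\<^sub>R b) + \<psi> (z - h *\<^sub>R b) - 2 * \<psi> z - h\<^sup>2 * Q b z =
         ((Q b (z + t *\<^sub>R b) - Q b z) / 2 + (Q b (z - t *\<^sub>R b) - Q b z) / 2) * h\<^sup>2"
        by (simp add: field_simps)
      have in1: "z + t *\<^sub>R b \<in> K1" "z - t *\<^sub>R b \<in> K1" "z \<in> K1"
      proof -
        show "z + t *\<^sub>R b \<in> K1" unfolding K1_def using z b t h
          by (intro CollectI exI[of _ z] exI[of _ "t *\<^sub>R b"]) auto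
        show "z - t *\<^sub>R b \<in> K1" unfolding K1_def using z b t h
          by (intro CollectI exI[of _ z] exI[of _ "- t *\<^sub>R b"]) auto
        show "z \<in> K1" unfolding K1_def using z by force
      qed
      have near: "dist (z + t *\<^sub>R b) z < \<delta>" "dist (z - t *\<^sub>R b) z < \<delta>"
        using t h b by (simp_all add: dist_norm)
      have avg: "\<bar>p / 2 + q / 2\<bar> \<le> e" if "\<bar>p\<bar> < e" "\<bar>q\<bar> < e" for p q e :: real
        using that by linarith
      have "\<bar>(Q b (z + t *\<^sub>R b) - Q b z) / 2 + (Q b (z - t *\<^sub>R b) - Q b z) / 2\<bar> \<le> \<eta> / d"
        by (rule avg[OF u[OF in1(3,1) near(1), unfolded dist_real_def] u[OF in1(3,2) near(2), unfolded dist_real_def]])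
      then show "\<bar>\<psi> (z + h *\<^sub>R b) + \<psi> (z - h *\<^sub>R b) - 2 * \<psi> z - h\<^sup>2 * Q b z\<bar> \<le> (\<eta> / d) * h\<^sup>2"
        unfolding eq abs_mult abs_power2 by (rule mult_right_mono) simp
    qed
    then show ?thesis unfolding eventually_at_right_field using \<delta>
      by (intro exI[of _ "min \<delta> 1"]) auto
  qed
  have "\<forall>\<^sub>F h in at_right 0. \<forall>b\<in>Basis. \<forall>z\<in>K.
      \<bar>\<psi> (z + h *\<^sub>R b) + \<psi> (z - h *\<^sub>R b) - 2 * \<psi> z - h\<^sup>2 * Q b z\<bar> \<le> (\<eta> / d) * h\<^sup>2"
    using single by (intro eventually_ball_finite) auto
  then show ?thesis
  proof (rule eventually_mono, intro ballI)
    fix h z assume A: "\<forall>b\<in>Basis. \<forall>z\<in>K.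
      \<bar>\<psi> (z + h *\<^sub>R b) + \<psi> (z - h *\<^sub>R b) - 2 * \<psi> z - h\<^sup>2 * Q b z\<bar> \<le> (\<eta> / d) * h\<^sup>2" and z: "z \<in> K"
    have "\<bar>\<Sum>b\<in>Basis. \<psi> (z + h *\<^sub>R b) + \<psi> (z - h *\<^sub>R b) - 2 * \<psi> z - h\<^sup>2 * Q b z\<bar>
       \<le> (\<Sum>b\<in>(Basis::'a set). (\<eta> / d) * h\<^sup>2)"
      using A z by (intro order_trans[OF sum_abs] sum_mono) auto
    also have "\<dots> = \<eta> * h\<^sup>2" using d by (simp add: d_def)
    finally show "\<bar>(\<Sum>b\<in>Basis. \<psi> (z + h *\<^sub>R b) + \<psi> (z - h *\<^sub>R b) - 2 * \<psi> z) - h\<^sup>2 * (\<Sum>b\<in>Basis. Q b z)\<bar> \<le> \<eta> * h\<^sup>2"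
      by (simp add: sum_subtractf sum_distrib_left)
  qed
qed

lemma second_difference_laplacian:
  fixes \<psi> :: "'a::euclidean_space \<Rightarrow> real"
  assumes \<psi>: "times_cont_diff 2 \<psi>" and K: "compact K" and \<eta>: "\<eta> > 0"
  shows "\<forall>\<^sub>F h in at_right 0. \<forall>z\<in>K.
    \<bar>(\<Sum>b\<in>Basis. \<psi> (z + h *\<^sub>R b) + \<psi> (z - h *\<^sub>R b) - 2 * \<psi> z) - h\<^sup>2 * laplacian \<psi> z\<bar> \<le> \<eta> * h\<^sup>2"
proof -
  have line: "((\<lambda>s. f (z + s *\<^sub>R b)) has_real_derivative frechet_derivative f (at z) b) (at 0)"
    if "f differentiable (at z)" for f :: "'a \<Rightarrow> real" and z b
  proof -
    have f: "(f has_derivative frechet_derivative f (at z)) (at (z + 0 *\<^sub>R b))"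
      using that frechet_derivative_works by auto
    have g: "((\<lambda>s::real. z + s *\<^sub>R b) has_derivative (\<lambda>s. s *\<^sub>R b)) (at 0)"
      by (auto intro!: derivative_eq_intros)
    have lin: "linear (frechet_derivative f (at z))"
      using f has_derivative_linear by blast
    have "((\<lambda>s. f (z + s *\<^sub>R b)) has_derivative (\<lambda>s. frechet_derivative f (at z) (s *\<^sub>R b))) (at 0)"
      using has_derivative_compose[OF g f] by simp
    then show ?thesis
      unfolding has_field_derivative_def
      by (simp add: linear_scale[OF lin] mult.commute[of _ "frechet_derivative f (at z) b"])
  qed
  have \<psi>': "\<And>x. \<psi> differentiable (at x)"
    "\<And>b x. (\<lambda>z. frechet_derivative \<psi> (at z) b) differentiable (at x)"
    "\<And>b. continuous_on UNIV (\<lambda>z. frechet_derivative (\<lambda>z. frechet_derivative \<psi> (at z) b) (at z) b)"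
    using \<psi> by (auto simp: numeral_2_eq_2)
  show ?thesis unfolding laplacian_def
    by (rule second_difference_approx[where P="\<lambda>b z. frechet_derivative \<psi> (at z) b"])
       (auto intro!: line \<psi>' K \<eta>)
qed

section \<open>Supersolutions from second differences\<close>

lemma integrable_compactly_supported:
  fixes h :: "'a::euclidean_space \<Rightarrow> real"
  assumes h: "continuous_on UNIV h" and K: "compact K" and z: "\<And>x. x \<notin> K \<Longrightarrow> h x = 0"
  shows "integrable lborel h"
proof -
  have "integrable lborel (\<lambda>x. indicator K x *\<^sub>R h x)"
    using borel_integrable_compact[OF K continuous_on_subset[OF h]] by simp
  moreover have "(\<lambda>x. indicator K x *\<^sub>R h x) = h"
  proof
    show "indicator K x *\<^sub>R h x = h x" for x by (cases "x \<in> K") (simp_all add: z)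
  qed
  ultimately show ?thesis by simp
qed

text \<open>
  Makes sense of the individual terms in the distributional inequality: a locally integrable
  function against a continuous function of compact support.
\<close>

lemma integrable_mult_compactly_supported:
  fixes h q :: "'a::euclidean_space \<Rightarrow> real"
  assumes h: "locally_integrable h" and q: "continuous_on UNIV q"
    and K: "compact K" and z: "\<And>x. x \<notin> K \<Longrightarrow> q x = 0"
  shows "integrable lborel (\<lambda>x. h x * q x)"
proof -
  have [measurable]: "q \<in> borel_measurable borel" using q by (rule borel_measurable_continuous_onI)
  obtain c where c: "\<And>x. x \<in> K \<Longrightarrow> \<bar>q x\<bar> \<le> c"
    using compact_imp_bounded[OF compact_continuous_image[OF continuous_on_subset[OF q] K]]
    unfolding bounded_iff by auto
  have i: "integrable lborel (\<lambda>x. indicator K x *\<^sub>R h x)"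
    using h K unfolding locally_integrable_def set_integrable_def by blast
  have "integrable lborel (\<lambda>x. (indicator K x *\<^sub>R h x) * q x)"
  proof (rule Bochner_Integration.integrable_bound[OF integrable_mult_right[OF i, of c]])
    show "(\<lambda>x. (indicator K x *\<^sub>R h x) * q x) \<in> borel_measurable lborel"
      using borel_measurable_integrable[OF i] by measurable
    show "AE x in lborel. norm ((indicator K x *\<^sub>R h x) * q x) \<le> norm (c * (indicator K x *\<^sub>R h x))"
    proof (intro AE_I2)
      fix x show "norm ((indicator K x *\<^sub>R h x) * q x) \<le> norm (c * (indicator K x *\<^sub>R h x))"
        using c[of x] by (auto simp: indicator_def abs_mult mult.commute[of c] intro!: mult_left_mono)
    qed
  qed
  moreover have "(\<lambda>x. (indicator K x *\<^sub>R h x) * q x) = (\<lambda>x. h x * q x)"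
  proof
    show "(indicator K x *\<^sub>R h x) * q x = h x * q x" for x by (cases "x \<in> K") (simp_all add: z)
  qed
  ultimately show ?thesis by simp
qed

lemma integral_translation:
  fixes h :: "'a::euclidean_space \<Rightarrow> real"
  assumes [measurable]: "h \<in> borel_measurable borel"
  shows "(LINT x|lborel. h (x + a)) = (LINT x|lborel. h x)"
proof -
  have "(LINT x|lborel. h x) = (LINT x|distr lborel borel ((+) a). h x)"
    by (simp add: lborel_distr_plus)
  also have "\<dots> = (LINT x|lborel. h (a + x))" by (subst integral_distr) auto
  finally show ?thesis by (simp add: add.commute)
qed

lemma times_cont_diff_continuous:
  assumes "times_cont_diff k \<psi>" shows "continuous_on UNIV \<psi>"
  using assms
proof (cases k)
  case (Suc m)
  then show ?thesis using assms
    by (auto intro!: continuous_at_imp_continuous_on differentiable_imp_continuous_within)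
qed auto

lemma continuous_on_laplacian:
  assumes "times_cont_diff 2 \<psi>" shows "continuous_on UNIV (laplacian \<psi>)"
proof -
  have "continuous_on UNIV (\<lambda>z. frechet_derivative (\<lambda>z. frechet_derivative \<psi> (at z) b) (at z) b)" for b
    using assms by (auto simp: numeral_2_eq_2)
  then show ?thesis unfolding laplacian_def[abs_def] by (intro continuous_on_sum) auto
qed

lemma laplacian_support:
  fixes \<psi> :: "'a::euclidean_space \<Rightarrow> real"
  assumes "open S" "x \<in> S" "\<And>y. y \<in> S \<Longrightarrow> \<psi> y = 0"
  shows "laplacian \<psi> x = 0"
proof -
  have loc: "frechet_derivative f (at y) b = 0" if "y \<in> S" "\<And>y. y \<in> S \<Longrightarrow> f y = 0" for f :: "'a \<Rightarrow> real" and y b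
  proof -
    have "(f has_derivative (\<lambda>_. 0)) (at y)"
      by (rule has_derivative_transform_within_open[OF has_derivative_const[of 0] assms(1)])
         (use that in auto)
    then show ?thesis by (simp add: frechet_derivative_at[symmetric])
  qed
  show ?thesis unfolding laplacian_def
    by (intro sum.neutral ballI loc assms) auto
qed

text \<open>
  If \<open>v - \<psi>\<close> has a local minimum at \<open>x0\<close>, then the second differences of \<open>\<psi>\<close> at \<open>x0\<close> are
  bounded by those of \<open>v\<close>, and after division by \<open>h\<^sup>2\<close> they tend to the Laplacian of \<open>\<psi>\<close>.
\<close>

lemma second_difference_imp_viscosity:
  fixes v :: "'a::euclidean_space \<Rightarrow> real"
  assumes v: "continuous_on UNIV v"
    and sd: "\<forall>\<^sub>F h in at_right 0. \<forall>x. (\<Sum>b\<in>Basis. v (x + h *\<^sub>R b) + v (x - h *\<^sub>R b) - 2 * v x)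
       \<le> - (g x (v x) + F) * h\<^sup>2"
  shows "viscosity_supersolution g F v"
  unfolding viscosity_supersolution_def lower_semicontinuous_def
proof (intro conjI allI impI)
  show "open {x. c < v x}" for c
    using open_Collect_less[OF continuous_on_const v] by simp
next
  fix \<psi> x0 assume A: "times_cont_diff 2 \<psi> \<and> (\<forall>\<^sub>F x in nhds x0. v x0 - \<psi> x0 \<le> v x - \<psi> x)"
  show "laplacian \<psi> x0 + g x0 (v x0) + F \<le> 0"
  proof (rule field_le_epsilon)
    fix \<eta> :: real assume \<eta>: "\<eta> > 0"
    have "\<forall>\<^sub>F h in at_right 0. \<forall>z\<in>{x0}.
        \<bar>(\<Sum>b\<in>Basis. \<psi> (z + h *\<^sub>R b) + \<psi> (z - h *\<^sub>R b) - 2 * \<psi> z) - h\<^sup>2 * laplacian \<psi> z\<bar> \<le> \<eta> * h\<^sup>2"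
      using A \<eta> by (intro second_difference_laplacian) auto
    moreover have lim: "filterlim (\<lambda>h. x0 + h *\<^sub>R b) (nhds x0) (at_right 0)" 
       "filterlim (\<lambda>h. x0 - h *\<^sub>R b) (nhds x0) (at_right 0)" for b
    proof -
      have "((\<lambda>h. x0 + h *\<^sub>R b) \<longlongrightarrow> x0 + 0 *\<^sub>R b) (at_right 0)" "((\<lambda>h. x0 - h *\<^sub>R b) \<longlongrightarrow> x0 - 0 *\<^sub>R b) (at_right 0)"
        by (intro tendsto_intros)+
      then show "filterlim (\<lambda>h. x0 + h *\<^sub>R b) (nhds x0) (at_right 0)" 
       "filterlim (\<lambda>h. x0 - h *\<^sub>R b) (nhds x0) (at_right 0)" by simp_all
    qed
    have "\<forall>\<^sub>F h in at_right 0. \<forall>b\<in>Basis. v x0 - \<psi> x0 \<le> v (x0 + h *\<^sub>R b) - \<psi> (x0 + h *\<^sub>R b)"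
      using A by (intro eventually_ball_finite ballI) (auto intro: eventually_compose_filterlim[OF _ lim(1)])
    moreover have "\<forall>\<^sub>F h in at_right 0. \<forall>b\<in>Basis. v x0 - \<psi> x0 \<le> v (x0 - h *\<^sub>R b) - \<psi> (x0 - h *\<^sub>R b)"
      using A by (intro eventually_ball_finite ballI) (auto intro: eventually_compose_filterlim[OF _ lim(2)])
    moreover have "\<forall>\<^sub>F h::real in at_right 0. 0 < h" by (simp add: eventually_at_right_less)
    ultimately have "\<forall>\<^sub>F h::real in at_right 0. laplacian \<psi> x0 + g x0 (v x0) + F \<le> 0 + \<eta>"
      using sd
    proof eventually_elim
      case (elim h)
      have "h\<^sup>2 * laplacian \<psi> x0 - \<eta> * h\<^sup>2 \<le> (\<Sum>b\<in>Basis. \<psi> (x0 + h *\<^sub>R b) + \<psi> (x0 - h *\<^sub>R b) - 2 * \<psi> x0)"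
        using elim(1) by auto
      also have "\<dots> \<le> (\<Sum>b\<in>Basis. v (x0 + h *\<^sub>R b) + v (x0 - h *\<^sub>R b) - 2 * v x0)"
        using elim(2,3) by (intro sum_mono) fastforce
      also have "\<dots> \<le> - (g x0 (v x0) + F) * h\<^sup>2" using elim(5) by blast
      finally have "(laplacian \<psi> x0 + g x0 (v x0) + F) * h\<^sup>2 \<le> \<eta> * h\<^sup>2" by (simp add: algebra_simps)
      then show ?case using elim(4) by simp
    qed
    then show "laplacian \<psi> x0 + g x0 (v x0) + F \<le> 0 + \<eta>"
      by (metis eventually_happens' trivial_limit_at_right_real)
  qed
qed

text \<open>
  Up to a small error, \<open>\<Delta>\<psi>\<close> is a second difference quotient of \<open>\<psi>\<close>. By translation invariance
  of Lebesgue measure the difference can be moved from \<open>\<psi>\<close> to \<open>v\<close>, where the hypothesis applies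
  because \<open>\<psi> \<ge> 0\<close>. The bound is uniform in \<open>x\<close>, so the total error is at most the small error
  times the integral of \<open>\<bar>v\<bar>\<close> over a compact neighbourhood of the support.
\<close>

lemma second_difference_imp_distributional:
  fixes v :: "'a::euclidean_space \<Rightarrow> real"
  assumes v: "continuous_on UNIV v"
    and gi: "locally_integrable (\<lambda>x. g x (v x))"
    and sd: "\<forall>\<^sub>F h in at_right 0. \<forall>x. (\<Sum>b\<in>Basis. v (x + h *\<^sub>R b) + v (x - h *\<^sub>R b) - 2 * v x)
       \<le> - (g x (v x) + F) * h\<^sup>2"
  shows "distributional_supersolution g F v"
  unfolding distributional_supersolution_def
proof (intro conjI allI impI)
  have "integrable lborel (\<lambda>x. indicator K x *\<^sub>R v x)" if "compact K" for K
    by (rule borel_integrable_compact[OF that continuous_on_subset[OF v]]) simp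
  then show "locally_integrable v" unfolding locally_integrable_def set_integrable_def by simp
next
  show "locally_integrable (\<lambda>x. g x (v x))" by fact
next
  fix \<psi> :: "'a \<Rightarrow> real" assume A: "smooth \<psi> \<and> compact (closure {x. \<psi> x \<noteq> 0}) \<and> (\<forall>x. 0 \<le> \<psi> x)"
  define S where "S = closure {x. \<psi> x \<noteq> 0}"
  define K where "K = {x + y | x y. x \<in> S \<and> y \<in> cball 0 1}"
  have S: "compact S" using A S_def by simp
  have K: "compact K" unfolding K_def by (rule compact_sums[OF S compact_cball])
  have SK: "S \<subseteq> K" unfolding K_def by force
  have \<psi>2: "times_cont_diff 2 \<psi>" using A smooth_def by blast
  have \<psi>c: "continuous_on UNIV \<psi>" using \<psi>2 by (rule times_cont_diff_continuous)
  have lc: "continuous_on UNIV (laplacian \<psi>)" by (rule continuous_on_laplacian[OF \<psi>2])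
  have \<psi>0: "\<psi> x = 0" if "x \<notin> S" for x
    using that closure_subset[of "{x. \<psi> x \<noteq> 0}"] unfolding S_def by (metis (mono_tags, lifting) mem_Collect_eq subsetD)
  have l0: "laplacian \<psi> x = 0" if "x \<notin> S" for x
    by (rule laplacian_support[of "- S"]) (simp_all add: open_Compl compact_imp_closed S that \<psi>0)
  have K0: "\<psi> (x + h *\<^sub>R b) = 0" "\<psi> (x - h *\<^sub>R b) = 0" if "x \<notin> K" "0 < h" "h \<le> 1" "b \<in> Basis" for x h b
  proof -
    have "x + h *\<^sub>R b \<notin> S"
    proof
      assume "x + h *\<^sub>R b \<in> S"
      then have "x \<in> K" unfolding K_def using that
        by (intro CollectI exI[of _ "x + h *\<^sub>R b"] exI[of _ "- h *\<^sub>R b"]) auto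
      then show False using that by simp
    qed
    then show "\<psi> (x + h *\<^sub>R b) = 0" by (rule \<psi>0)
    have "x - h *\<^sub>R b \<notin> S"
    proof
      assume "x - h *\<^sub>R b \<in> S"
      then have "x \<in> K" unfolding K_def using that
        by (intro CollectI exI[of _ "x - h *\<^sub>R b"] exI[of _ "h *\<^sub>R b"]) auto
      then show False using that by simp
    qed
    then show "\<psi> (x - h *\<^sub>R b) = 0" by (rule \<psi>0)
  qed
  have \<psi>K: "\<psi> x = 0" "laplacian \<psi> x = 0" if "x \<notin> K" for x using that SK \<psi>0 l0 by auto
  have cont_sh: "continuous_on UNIV (\<lambda>x. q (x + a))" "continuous_on UNIV (\<lambda>x. q (x - a))"
    if "continuous_on UNIV q" for q :: "'a \<Rightarrow> real" and a
    by (auto intro!: continuous_on_compose2[OF that] continuous_intros)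
  have m [measurable]: "v \<in> borel_measurable borel" "\<psi> \<in> borel_measurable borel" "laplacian \<psi> \<in> borel_measurable borel"
    using v \<psi>c lc by (auto intro: borel_measurable_continuous_onI)
  define G where "G x = (g x (v x) + F) * \<psi> x" for x
  have G: "integrable lborel G"
  proof -
    have "integrable lborel (\<lambda>x. g x (v x) * \<psi> x)"
      by (rule integrable_mult_compactly_supported[OF gi \<psi>c K \<psi>K(1)])
    moreover have "integrable lborel (\<lambda>x. F * \<psi> x)"
      by (rule integrable_compactly_supported[OF _ K]) (auto intro!: continuous_intros \<psi>c simp: \<psi>K)
    ultimately show ?thesis unfolding G_def distrib_right by (rule Bochner_Integration.integrable_add)
  qed
  \<comment> \<open>\<open>V\<close> controls the error of replacing \<open>\<Delta>\<psi>\<close> by a difference quotient.\<close>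
  define V where "V x = indicator K x * \<bar>v x\<bar>" for x
  have V: "integrable lborel V"
    using borel_integrable_compact[OF K continuous_on_subset[of _ "\<lambda>x. \<bar>v x\<bar>"]] v
    unfolding V_def by (auto intro!: continuous_intros)
  have vl: "integrable lborel (\<lambda>x. v x * laplacian \<psi> x)"
    by (rule integrable_compactly_supported[OF _ K]) (auto intro!: continuous_intros v lc simp: \<psi>K)
  have main: "(LINT x|lborel. v x * laplacian \<psi> x + G x) \<le> 0 + \<epsilon>" if \<epsilon>: "\<epsilon> > 0" for \<epsilon>
  proof -
    define \<eta> where "\<eta> = \<epsilon> / ((LINT x|lborel. V x) + 1)"
    have V0: "(LINT x|lborel. V x) \<ge> 0" by (rule integral_nonneg_AE) (auto simp: V_def)
    have \<eta>: "\<eta> > 0" "\<eta> * (LINT x|lborel. V x) \<le> \<epsilon>"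
      unfolding \<eta>_def using \<epsilon> V0 by (auto simp: field_simps)
    have "\<forall>\<^sub>F h in at_right 0. \<forall>z\<in>K.
        \<bar>(\<Sum>b\<in>Basis. \<psi> (z + h *\<^sub>R b) + \<psi> (z - h *\<^sub>R b) - 2 * \<psi> z) - h\<^sup>2 * laplacian \<psi> z\<bar> \<le> \<eta> * h\<^sup>2"
      using \<psi>2 K \<eta> by (intro second_difference_laplacian) auto
    moreover have "\<forall>\<^sub>F h::real in at_right 0. 0 < h" by (simp add: eventually_at_right_less)
    moreover have "\<forall>\<^sub>F h::real in at_right 0. h < 1" by (rule eventually_at_rightI[of _ 1]) auto
    ultimately have "\<forall>\<^sub>F h::real in at_right 0. (LINT x|lborel. v x * laplacian \<psi> x + G x) \<le> 0 + \<epsilon>"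
      using sd
    proof eventually_elim
      case (elim h)
      have h: "0 < h" "h < 1" using elim by auto
      define D where "D x = (\<Sum>b\<in>Basis. \<psi> (x + h *\<^sub>R b) + \<psi> (x - h *\<^sub>R b) - 2 * \<psi> x)" for x
      have pt: "v x * laplacian \<psi> x \<le> v x * D x / h\<^sup>2 + \<eta> * V x" for x
      proof (cases "x \<in> K")
        case True
        have "\<bar>D x - h\<^sup>2 * laplacian \<psi> x\<bar> \<le> \<eta> * h\<^sup>2" using elim(1) True D_def by auto
        then have "\<bar>D x / h\<^sup>2 - laplacian \<psi> x\<bar> \<le> \<eta>" using h
          by (auto simp: abs_le_iff field_simps)
        then have "\<bar>v x\<bar> * \<bar>D x / h\<^sup>2 - laplacian \<psi> x\<bar> \<le> \<bar>v x\<bar> * \<eta>" by (intro mult_left_mono) auto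
        then have "\<bar>v x * D x / h\<^sup>2 - v x * laplacian \<psi> x\<bar> \<le> \<bar>v x\<bar> * \<eta>"
          by (simp add: abs_mult[symmetric] algebra_simps)
        then show ?thesis using True by (auto simp: V_def algebra_simps abs_le_iff)
      next
        case False
        then have "D x = 0" unfolding D_def using K0[OF False, of h] h \<psi>K[OF False] by auto
        then show ?thesis using \<psi>K[OF False] False by (simp add: V_def)
      qed
      have ib: "integrable lborel (\<lambda>x. v x * \<psi> (x + h *\<^sub>R b))" "integrable lborel (\<lambda>x. v x * \<psi> (x - h *\<^sub>R b))"
        "integrable lborel (\<lambda>x. v (x - h *\<^sub>R b) * \<psi> x)" "integrable lborel (\<lambda>x. v (x + h *\<^sub>R b) * \<psi> x)"
        "integrable lborel (\<lambda>x. v x * \<psi> x)"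
        if "b \<in> Basis" for b
        using that h K0 by (auto intro!: integrable_compactly_supported[OF _ K] continuous_intros v cont_sh \<psi>c simp: \<psi>K)
      have "(LINT x|lborel. v x * D x) = (\<Sum>b\<in>Basis. (LINT x|lborel. v x * \<psi> (x + h *\<^sub>R b))
          + (LINT x|lborel. v x * \<psi> (x - h *\<^sub>R b)) - 2 * (LINT x|lborel. v x * \<psi> x))"
      proof -
        have "(\<lambda>x. v x * D x) = (\<lambda>x. \<Sum>b\<in>Basis. v x * \<psi> (x + h *\<^sub>R b) + v x * \<psi> (x - h *\<^sub>R b) - 2 * (v x * \<psi> x))"
          unfolding D_def sum_distrib_left by (intro ext sum.cong refl) (simp add: algebra_simps)
        then show ?thesis using ib by simp
      qed
      also have "\<dots> = (\<Sum>b\<in>Basis. (LINT x|lborel. v (x - h *\<^sub>R b) * \<psi> x)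
          + (LINT x|lborel. v (x + h *\<^sub>R b) * \<psi> x) - 2 * (LINT x|lborel. v x * \<psi> x))"
      proof (rule sum.cong[OF refl])
        fix b :: 'a
        have "(LINT x|lborel. v (x - h *\<^sub>R b) * \<psi> x) = (LINT x|lborel. v x * \<psi> (x + h *\<^sub>R b))"
          by (subst integral_translation[where a="h *\<^sub>R b", symmetric]) auto
        moreover have "(LINT x|lborel. v (x + h *\<^sub>R b) * \<psi> x) = (LINT x|lborel. v x * \<psi> (x - h *\<^sub>R b))"
          by (subst integral_translation[where a="- h *\<^sub>R b", symmetric]) auto
        ultimately show "(LINT x|lborel. v x * \<psi> (x + h *\<^sub>R b)) + (LINT x|lborel. v x * \<psi> (x - h *\<^sub>R b)) - 2 * (LINT x|lborel. v x * \<psi> x)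
          = (LINT x|lborel. v (x - h *\<^sub>R b) * \<psi> x) + (LINT x|lborel. v (x + h *\<^sub>R b) * \<psi> x) - 2 * (LINT x|lborel. v x * \<psi> x)"
          by simp
      qed
      also have "\<dots> = (LINT x|lborel. (\<Sum>b\<in>Basis. v (x + h *\<^sub>R b) + v (x - h *\<^sub>R b) - 2 * v x) * \<psi> x)"
      proof -
        have "(\<lambda>x. (\<Sum>b\<in>Basis. v (x + h *\<^sub>R b) + v (x - h *\<^sub>R b) - 2 * v x) * \<psi> x)
          = (\<lambda>x. \<Sum>b\<in>Basis. v (x - h *\<^sub>R b) * \<psi> x + v (x + h *\<^sub>R b) * \<psi> x - 2 * (v x * \<psi> x))"
          unfolding sum_distrib_right by (intro ext sum.cong refl) (simp add: algebra_simps)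
        then show ?thesis using ib by simp
      qed
      also have "\<dots> \<le> (LINT x|lborel. - h\<^sup>2 * G x)"
      proof (rule integral_mono)
        show "integrable lborel (\<lambda>x. (\<Sum>b\<in>Basis. v (x + h *\<^sub>R b) + v (x - h *\<^sub>R b) - 2 * v x) * \<psi> x)"
          by (rule integrable_compactly_supported[OF _ K]) (auto intro!: continuous_intros v cont_sh \<psi>c simp: \<psi>K)
        show "integrable lborel (\<lambda>x. - h\<^sup>2 * G x)" using G by simp
        fix x
        have "(\<Sum>b\<in>Basis. v (x + h *\<^sub>R b) + v (x - h *\<^sub>R b) - 2 * v x) * \<psi> x \<le> - (g x (v x) + F) * h\<^sup>2 * \<psi> x"
          using elim(4) A by (intro mult_right_mono) auto
        then show "(\<Sum>b\<in>Basis. v (x + h *\<^sub>R b) + v (x - h *\<^sub>R b) - 2 * v x) * \<psi> x \<le> - h\<^sup>2 * G x"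
          by (simp add: G_def algebra_simps)
      qed
      also have "\<dots> = - h\<^sup>2 * (LINT x|lborel. G x)" by simp
      finally have fin: "(LINT x|lborel. v x * D x) / h\<^sup>2 \<le> - (LINT x|lborel. G x)"
        using h by (simp add: field_simps)
      have iD: "integrable lborel (\<lambda>x. v x * D x / h\<^sup>2)"
      proof (rule integrable_compactly_supported[OF _ K])
        show "continuous_on UNIV (\<lambda>x. v x * D x / h\<^sup>2)" unfolding D_def using h
          by (auto intro!: continuous_intros v cont_sh \<psi>c)
        show "v x * D x / h\<^sup>2 = 0" if "x \<notin> K" for x
          unfolding D_def using K0[OF that, of h] h \<psi>K[OF that] by auto
      qed
      have "(LINT x|lborel. v x * laplacian \<psi> x) \<le> (LINT x|lborel. v x * D x / h\<^sup>2 + \<eta> * V x)"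
        by (rule integral_mono[OF vl _ pt]) (use iD V in auto)
      also have "\<dots> = (LINT x|lborel. v x * D x) / h\<^sup>2 + \<eta> * (LINT x|lborel. V x)"
        using iD V by simp
      also have "\<dots> \<le> - (LINT x|lborel. G x) + \<epsilon>" using fin \<eta> by simp
      finally show ?case using vl G by simp
    qed
    then show ?thesis by (metis eventually_happens' trivial_limit_at_right_real)
  qed
  have "(LINT x|lborel. v x * laplacian \<psi> x + G x) \<le> 0"
    by (rule field_le_epsilon) (rule main)
  then show "(LINT x|lborel. v x * laplacian \<psi> x + (g x (v x) + F) * \<psi> x) \<le> 0" by (simp add: G_def)
qed

text \<open>
  For the distributional part this is monotonicity of the integral, which requires that both
  integrands are integrable; the Bochner integral of a non-integrable function is 0.
\<close>

lemma stationary_supersolution_antimono: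
  assumes w: "stationary_supersolution g F' w" and F: "F \<le> F'"
  shows "stationary_supersolution g F w"
proof -
  have li: "locally_integrable w" "locally_integrable (\<lambda>x. g x (w x))"
    and d: "\<And>\<psi>. smooth \<psi> \<and> compact (closure {x. \<psi> x \<noteq> 0}) \<and> (\<forall>x. 0 \<le> \<psi> x) \<Longrightarrow>
        (LINT x|lborel. w x * laplacian \<psi> x + (g x (w x) + F') * \<psi> x) \<le> 0"
    using w by (auto simp: stationary_supersolution_def distributional_supersolution_def)
  have "(LINT x|lborel. w x * laplacian \<psi> x + (g x (w x) + F) * \<psi> x) \<le> 0"
    if \<psi>: "smooth \<psi> \<and> compact (closure {x. \<psi> x \<noteq> 0}) \<and> (\<forall>x. 0 \<le> \<psi> x)" for \<psi>
  proof -
    define K where "K = closure {x. \<psi> x \<noteq> 0}"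
    have K: "compact K" and z: "\<And>x. x \<notin> K \<Longrightarrow> \<psi> x = 0"
      using \<psi> closure_subset[of "{x. \<psi> x \<noteq> 0}"] by (auto simp: K_def)
    have \<psi>2: "times_cont_diff 2 \<psi>" using \<psi> by (simp add: smooth_def)
    have \<psi>c: "continuous_on UNIV \<psi>" by (rule times_cont_diff_continuous[OF \<psi>2])
    have l0: "laplacian \<psi> x = 0" if "x \<notin> K" for x
      by (rule laplacian_support[of "- K"]) (simp_all add: open_Compl compact_imp_closed K that z)
    have i: "integrable lborel (\<lambda>x. w x * laplacian \<psi> x)" "integrable lborel (\<lambda>x. g x (w x) * \<psi> x)"
      "integrable lborel (\<lambda>x. C * \<psi> x)" for C
      using integrable_mult_compactly_supported[OF li(1) continuous_on_laplacian[OF \<psi>2] K l0]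
        integrable_mult_compactly_supported[OF li(2) \<psi>c K z] integrable_compactly_supported[OF \<psi>c K z] by auto
    have "(LINT x|lborel. w x * laplacian \<psi> x + (g x (w x) + F) * \<psi> x)
        \<le> (LINT x|lborel. w x * laplacian \<psi> x + (g x (w x) + F') * \<psi> x)"
      unfolding distrib_right
      by (intro integral_mono Bochner_Integration.integrable_add i add_left_mono mult_right_mono) (use F \<psi> in auto)
    also have "\<dots> \<le> 0" by (rule d[OF \<psi>])
    finally show ?thesis .
  qed
  then have "distributional_supersolution g F w" using li by (simp add: distributional_supersolution_def)
  moreover have "viscosity_supersolution g F w"
    using w F unfolding stationary_supersolution_def viscosity_supersolution_def
    by (meson add_left_mono order_trans)
  ultimately show ?thesis by (simp add: stationary_supersolution_def)
qed

section \<open>Lipschitz percolation\<close>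

text \<open>
  Paths in \<open>'k \<times> \<nat>\<close> start at height 0, may step up only into a site that satisfies \<open>C\<close> (a closed
  site), and may always step down while moving sideways by an element of \<open>E\<close>. The lowest
  unreached height over each \<open>k\<close> is the desired surface: its site is not closed, since the site
  below it is reached, and the free downward steps make it Lipschitz.
\<close>

inductive reach :: "'k::ab_group_add set \<Rightarrow> ('k \<times> nat \<Rightarrow> bool) \<Rightarrow> 'k \<Rightarrow> nat \<Rightarrow> bool"
  for E C where
  ground: "reach E C k 0"
| up: "reach E C k j \<Longrightarrow> C (k, Suc j) \<Longrightarrow> reach E C k (Suc j)"
| down: "reach E C k (Suc j) \<Longrightarrow> e \<in> E \<Longrightarrow> reach E C (k + e) j"

text \<open>
  A path is encoded backwards from its end point \<open>z\<close>: \<open>None\<close> undoes an upward step, \<open>Some e\<close> a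
  downward step with offset \<open>e\<close>. The list collects the sites that are entered by upward steps,
  which are the ones that have to be closed.
\<close>

fun up_sites :: "'k::ab_group_add \<times> nat \<Rightarrow> 'k option list \<Rightarrow> ('k \<times> nat) list" where
  "up_sites z [] = []"
| "up_sites (k, j) (None # p) = (k, j) # up_sites (k, j - 1) p"
| "up_sites (k, j) (Some e # p) = up_sites (k - e, Suc j) p"

fun backward_path :: "'k::ab_group_add set \<Rightarrow> ('k \<times> nat \<Rightarrow> bool) \<Rightarrow> 'k \<times> nat \<Rightarrow> 'k option list \<Rightarrow> bool" where
  "backward_path E C (k, j) [] \<longleftrightarrow> j = 0"
| "backward_path E C (k, j) (None # p) \<longleftrightarrow> j > 0 \<and> C (k, j) \<and> backward_path E C (k, j - 1) p"
| "backward_path E C (k, j) (Some e # p) \<longleftrightarrow> e \<in> E \<and> backward_path E C (k - e, Suc j) p"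

lemma length_up_sites: "length (up_sites z p) \<le> length p"
  by (induction z p rule: up_sites.induct) auto

text \<open>
  Loop erasure: a site entered by an upward step is the end point of an initial part of the path.
\<close>

lemma backward_path_truncate:
  assumes "backward_path E C z p" "distinct (up_sites z p)" "s \<in> set (up_sites z p)"
  shows "\<exists>p'. backward_path E C s p' \<and> distinct (up_sites s p')"
  using assms
proof (induction E C z p rule: backward_path.induct)
  case (2 E C k j p)
  show ?case
  proof (cases "s = (k, j)")
    case True
    then show ?thesis using "2.prems" by (intro exI[of _ "None # p"]) auto
  next
    case False
    then show ?thesis using 2 by auto
  qed
qed auto

text \<open>
  Only the sites entered by upward steps have to be distinct, since each of them contributes a
  factor to the probability of the path; other vertices may repeat. So loops are erased only when
  an upward step would enter such a site for the second time.
\<close>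

lemma reach_imp_backward_path:
  assumes "reach E C k j"
  shows "\<exists>p. backward_path E C (k, j) p \<and> distinct (up_sites (k, j) p)"
  using assms
proof induction
  case (ground k)
  show ?case by (intro exI[of _ "[]"]) auto
next
  case (up k j)
  then obtain p where p: "backward_path E C (k, j) p" "distinct (up_sites (k, j) p)" by blast
  show ?case
  proof (cases "(k, Suc j) \<in> set (up_sites (k, j) p)")
    case True
    then show ?thesis using backward_path_truncate[OF p] by blast
  next
    case False
    then show ?thesis using p up by (intro exI[of _ "None # p"]) auto
  qed
next
  case (down k j e)
  then obtain p where p: "backward_path E C (k, Suc j) p" "distinct (up_sites (k, Suc j) p)" by blast
  then show ?case using down by (intro exI[of _ "Some e # p"]) auto
qed

text \<open>
  A path starts at height 0, hence it has \<open>snd z\<close> more upward than downward steps. In particular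
  at least half of its steps are upward, which is what makes the path counting argument work.
\<close>

lemma backward_path_sites:
  assumes "backward_path E C z p"
  shows "length p + snd z = 2 * length (up_sites z p)"
    and "set p \<subseteq> insert None (Some ` E)"
    and "\<forall>s\<in>set (up_sites z p). C s"
  using assms by (induction E C z p rule: backward_path.induct) auto

lemma lipschitz_surface:
  fixes C :: "(int ^ 'n) \<times> nat \<Rightarrow> bool"
  defines "E \<equiv> {e :: int ^ 'n. \<forall>i. \<bar>e $ i\<bar> \<le> 1}"
  assumes nr: "\<And>k. \<exists>j. \<not> reach E C k j"
  shows "\<exists>H :: int ^ 'n \<Rightarrow> nat. (\<forall>k. \<not> C (k, H k)) \<and>
    (\<forall>m k k'. (\<forall>i. \<bar>k $ i - k' $ i\<bar> \<le> int m) \<longrightarrow> H k \<le> H k' + m)"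
proof -
  define H where "H k = (LEAST j. \<not> reach E C k j)" for k
  have nH: "\<not> reach E C k (H k)" for k unfolding H_def by (rule LeastI_ex[OF nr])
  have H: "H k \<le> j" if "\<not> reach E C k j" for k j unfolding H_def by (rule Least_le[where P="\<lambda>j. \<not> reach E C k j", OF that])
  have "\<not> C (k, H k)" for k
  proof
    assume C: "C (k, H k)"
    have "H k \<noteq> 0"
    proof
      assume "H k = 0"
      then show False using nH[of k] by (simp add: reach.ground)
    qed
    then obtain j where j: "H k = Suc j" using not0_implies_Suc by blast
    then have "reach E C k j" using H[of k j] by auto
    then have "reach E C k (H k)" using reach.up[of E C k j] C j by simp
    then show False using nH by blast
  qed
  moreover have st: "H k \<le> H k' + 1" if "k' - k \<in> E" for k k'
  proof -
    have "\<not> reach E C k (Suc (H k'))"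
      using reach.down[OF _ that, of C k "H k'"] nH[of k'] by auto
    then show ?thesis using H by fastforce
  qed
  have "H k \<le> H k' + m" if "\<forall>i. \<bar>k $ i - k' $ i\<bar> \<le> int m" for m k k'
    using that
  proof (induction m arbitrary: k)
    case 0
    then have "k = k'" by (simp add: vec_eq_iff)
    then show ?case by simp
  next
    case (Suc m)
    \<comment> \<open>One sup-norm step from \<open>k\<close> towards \<open>k'\<close>, in all coordinates at once.\<close>
    define k2 where "k2 = (\<chi> i. k $ i - sgn (k $ i - k' $ i))"
    have "\<bar>k2 $ i - k' $ i\<bar> \<le> int m" for i
    proof -
      have "\<bar>k $ i - k' $ i\<bar> \<le> int (Suc m)" using Suc.prems by blast
      then show ?thesis unfolding k2_def by (auto simp: sgn_if)
    qed
    then have "H k2 \<le> H k' + m" using Suc.IH by blast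
    moreover have "H k \<le> H k2 + 1"
      by (rule st) (auto simp: E_def k2_def sgn_if)
    ultimately show ?case by simp
  qed
  ultimately show ?thesis by blast
qed

lemma finite_bounded_lattice: "finite {k :: int ^ 'n. \<forall>i. \<bar>k $ i\<bar> \<le> m}"
proof -
  have "{k :: int ^ 'n. \<forall>i. \<bar>k $ i\<bar> \<le> m} \<subseteq> (\<lambda>g. \<chi> i. g i) ` (PiE UNIV (\<lambda>_. {-m..m}))"
  proof
    fix e :: "int ^ 'n" assume "e \<in> {e. \<forall>i. \<bar>e $ i\<bar> \<le> m}"
    then show "e \<in> (\<lambda>g. \<chi> i. g i) ` (PiE UNIV (\<lambda>_. {-m..m}))"
      by (intro image_eqI[of _ _ "\<lambda>i. e $ i"]) (auto simp: PiE_UNIV_domain abs_le_iff minus_le_iff)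
  qed
  then show ?thesis by (rule finite_subset) (intro finite_imageI finite_PiE, auto)
qed

context prob_space begin

text \<open>
  Path counting. There are at most \<open>c\<^sup>m\<close> codes of length \<open>m\<close>, and a given one is realised with
  probability at most \<open>q\<^sup>m\<^sup>/\<^sup>2 \<le> (2 c)\<^sup>-\<^sup>m\<close>, because at least \<open>m/2\<close> distinct sites have to be closed.
  Reaching height \<open>j\<close> takes at least \<open>j\<close> steps, so its probability is at most
  \<open>\<Sum>\<^sub>m\<^sub>\<ge>\<^sub>j 2\<^sup>-\<^sup>m\<close>, which is summable in \<open>j\<close>. Independence of the sites enters in the form of a bound on
  the probability that all sites of a finite set are closed.
\<close>

lemma AE_not_reach:
  fixes C :: "'a \<Rightarrow> 'k::ab_group_add \<times> nat \<Rightarrow> bool"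
  assumes E: "finite E"
    and meas: "\<And>s. {\<omega> \<in> space M. C \<omega> s} \<in> events"
    and q: "q \<ge> 0" "(2 * (real (card E) + 1))\<^sup>2 * q \<le> 1"
    and closed: "\<And>S. finite S \<Longrightarrow> prob {\<omega> \<in> space M. \<forall>s\<in>S. C \<omega> s} \<le> q ^ card S"
  shows "AE \<omega> in M. \<exists>j. \<not> reach E (C \<omega>) k j"
proof -
  define A where "A = insert None (Some ` E)"
  have finA: "finite A" using E A_def by simp
  define c where "c = real (card A)"
  have c: "c \<le> real (card E) + 1" "c \<ge> 1" 
  proof -
    have "card A \<le> Suc (card (Some ` E))" unfolding A_def by (rule card_insert_le_m1) auto
    also have "\<dots> \<le> Suc (card E)" using card_image_le[OF E] by simp
    finally show "c \<le> real (card E) + 1" by (simp add: c_def)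
    have "card A \<ge> 1" using finA A_def by (simp add: Suc_le_eq card_gt_0_iff)
    then show "c \<ge> 1" by (simp add: c_def)
  qed
  have "(2 * c)\<^sup>2 * q \<le> (2 * (real (card E) + 1))\<^sup>2 * q"
    using c q by (intro mult_right_mono power_mono) auto
  then have cq: "(2 * c)\<^sup>2 * q \<le> 1" using q by simp
  define ev where "ev S = {\<omega> \<in> space M. \<forall>s\<in>S. C \<omega> s}" for S
  have ev: "ev S \<in> events" if "finite S" for S
    unfolding ev_def using that meas by (intro sets.sets_Collect_finite_All) auto
  define L where "L j m = {p. set p \<subseteq> A \<and> length p = m \<and> distinct (up_sites (k, j) p) \<and> m + j = 2 * length (up_sites (k, j) p)}" for j m
  have finL: "finite (L j m)" for j m
    by (rule finite_subset[OF _ finite_lists_length_eq[OF finA, of m]]) (auto simp: L_def)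
  have cardL: "real (card (L j m)) \<le> c ^ m" for j m
  proof -
    have "card (L j m) \<le> card {p. set p \<subseteq> A \<and> length p = m}"
      by (rule card_mono[OF finite_lists_length_eq[OF finA]]) (auto simp: L_def)
    also have "\<dots> = card A ^ m" by (rule card_lists_length_eq[OF finA])
    finally show ?thesis unfolding c_def by (metis of_nat_le_iff of_nat_power)
  qed
  define B where "B j m = (\<Union>p\<in>L j m. ev (set (up_sites (k, j) p)))" for j m
  have B: "B j m \<in> events" for j m unfolding B_def using finL ev by auto
  have pB: "prob (B j m) \<le> (1/2) ^ j * (1/2) ^ (m - j)" for j m
  proof (cases "j \<le> m")
    case False
    have "L j m = {}"
    proof (rule ccontr)
      assume "L j m \<noteq> {}"
      then obtain p where "p \<in> L j m" by blast
      then show False using False length_up_sites[of "(k, j)" p] by (simp add: L_def)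
    qed
    then show ?thesis by (simp add: B_def)
  next
    case True
    have "prob (B j m) \<le> (\<Sum>p\<in>L j m. prob (ev (set (up_sites (k, j) p))))"
      unfolding B_def using finL ev by (intro finite_measure_subadditive_finite) auto
    also have "\<dots> \<le> (\<Sum>p\<in>L j m. (1 / (2 * c)) ^ m)"
    proof (rule sum_mono)
      fix p assume p: "p \<in> L j m"
      define u where "u = length (up_sites (k, j) p)"
      have u: "m \<le> 2 * u" "card (set (up_sites (k, j) p)) = u"
        using p by (auto simp: L_def u_def distinct_card)
      have "prob (ev (set (up_sites (k, j) p))) \<le> q ^ u"
        unfolding ev_def using closed[of "set (up_sites (k, j) p)"] u by simp
      also have "\<dots> \<le> ((1 / (2 * c))\<^sup>2) ^ u"
        using q cq c by (intro power_mono) (auto simp: field_simps power2_eq_square)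
      also have "\<dots> = (1 / (2 * c)) ^ (2 * u)" by (simp add: power_mult)
      also have "\<dots> \<le> (1 / (2 * c)) ^ m" using c u by (intro power_decreasing) auto
      finally show "prob (ev (set (up_sites (k, j) p))) \<le> (1 / (2 * c)) ^ m" .
    qed
    also have "\<dots> \<le> c ^ m * (1 / (2 * c)) ^ m"
      using cardL[of j m] c by (simp add: mult_right_mono)
    also have "\<dots> = (1/2) ^ m" using c by (simp add: power_mult_distrib[symmetric])
    also have "\<dots> = (1/2) ^ j * (1/2) ^ (m - j)" using True by (simp add: power_add[symmetric])
    finally show ?thesis .
  qed
  have pB': "prob (B j (j + m)) \<le> (1/2) ^ j * (1/2) ^ m" for j m using pB[of j "j + m"] by simp
  define Z where "Z j = (\<Union>m. B j (j + m))" for j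
  have Z: "Z j \<in> events" for j unfolding Z_def using B by auto
  have sm: "summable (\<lambda>m. (1/2::real) ^ j * (1/2) ^ m)" for j by (intro summable_mult summable_geometric) auto
  have pZ: "prob (Z j) \<le> 2 * (1/2) ^ j" for j
  proof -
    have s: "summable (\<lambda>m. prob (B j (j + m)))"
      by (rule summable_comparison_test'[OF sm[of j]]) (use pB' in auto)
    have "prob (Z j) \<le> (\<Sum>m. prob (B j (j + m)))"
      unfolding Z_def by (rule finite_measure_subadditive_countably[OF _ s]) (use B in auto)
    also have "\<dots> \<le> (\<Sum>m. (1/2) ^ j * (1/2) ^ m)" by (rule suminf_le[OF pB' s sm])
    also have "\<dots> = (1/2) ^ j * (\<Sum>m. (1/2) ^ m)" by (rule suminf_mult) auto
    also have "\<dots> = 2 * (1/2) ^ j" by (simp add: suminf_geometric)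
    finally show ?thesis .
  qed
  have "AE \<omega> in M. \<forall>\<^sub>F j in sequentially. \<omega> \<in> space M - Z j"
  proof (rule borel_cantelli_AE1[OF Z])
    show "emeasure M (Z j) < \<infinity>" for j by (simp add: emeasure_eq_measure)
    show "summable (\<lambda>j. prob (Z j))"
      by (rule summable_comparison_test'[where g="\<lambda>j. 2 * (1/2) ^ j"])
         (use pZ in \<open>auto intro!: summable_mult summable_geometric\<close>)
  qed
  then show ?thesis
  proof (rule AE_mp, intro AE_I2 impI)
    fix \<omega> assume w: "\<omega> \<in> space M" and "\<forall>\<^sub>F j in sequentially. \<omega> \<in> space M - Z j"
    then obtain j where j: "\<omega> \<notin> Z j" by (metis DiffD2 eventually_happens' sequentially_bot)
    have "\<not> reach E (C \<omega>) k j"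
    proof
      assume "reach E (C \<omega>) k j"
      then obtain p where p: "backward_path E (C \<omega>) (k, j) p" "distinct (up_sites (k, j) p)"
        using reach_imp_backward_path by blast
      have "j \<le> length p" using backward_path_sites(1)[OF p(1)] length_up_sites[of "(k, j)" p] by simp
      then obtain m where m: "length p = j + m" using le_Suc_ex by blast
      have "p \<in> L j (j + m)" unfolding L_def A_def
        using backward_path_sites[OF p(1)] p(2) m by auto
      moreover have "\<omega> \<in> ev (set (up_sites (k, j) p))"
        using backward_path_sites(3)[OF p(1)] w by (auto simp: ev_def)
      ultimately have "\<omega> \<in> Z j" unfolding Z_def B_def by blast
      then show False using j by simp
    qed
    then show "\<exists>j. \<not> reach E (C \<omega>) k j" by blast
  qed
qed

end

section \<open>Strong obstacles in a Poisson process\<close>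

lemma point_count_eq_of_nat:
  "point_count X A \<omega> = of_nat m \<longleftrightarrow> finite {k. X k \<omega> \<in> A} \<and> card {k. X k \<omega> \<in> A} = m"
  unfolding point_count_def by (auto simp: emeasure_count_space)

lemma poisson_weights_sums: "(\<lambda>m. (p * \<mu>) ^ m / fact m * exp (- \<mu>)) sums exp (- (\<mu> * (1 - p)))" for p \<mu> :: real
proof -
  have "(\<lambda>m. (p * \<mu>) ^ m / fact m) sums exp (p * \<mu>)"
    using exp_converges[of "p * \<mu>"] by (simp add: divide_inverse mult.commute)
  from sums_mult2[OF this, of "exp (- \<mu>)"] show ?thesis
    by (simp add: exp_add[symmetric] algebra_simps)
qed

context prob_space begin

text \<open>
  The Poisson weights sum to 1, which leaves no mass for an infinite count.
\<close>

lemma AE_finitely_many_points: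
  fixes X :: "nat \<Rightarrow> 'a \<Rightarrow> 'b::euclidean_space"
  assumes X: "poisson_process M lam D X"
    and A: "A \<in> sets borel" "A \<subseteq> D" "emeasure lborel A < \<infinity>"
  shows "AE \<omega> in M. finite {k. X k \<omega> \<in> A}"
proof -
  have [measurable]: "X k \<in> borel_measurable M" for k using X by (simp add: poisson_process_def)
  note A(1)[measurable]
  define N where "N m = {\<omega> \<in> space M. finite {k. X k \<omega> \<in> A} \<and> card {k. X k \<omega> \<in> A} = m}" for m
  define \<mu> where "\<mu> = lam * measure lborel A"
  have pN: "prob (N m) = \<mu> ^ m / fact m * exp (- \<mu>)" for m
    using X A unfolding poisson_process_def N_def \<mu>_def by (simp add: point_count_eq_of_nat)
  have N: "N m \<in> events" for m
  proof -
    have "N m = (\<Union>I\<in>{I. finite I \<and> card I = m}. {\<omega> \<in> space M. \<forall>k. (X k \<omega> \<in> A) = (k \<in> I)})"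
      by (fastforce simp: N_def)
    moreover have "countable {I :: nat set. finite I \<and> card I = m}"
      by (rule countable_subset[OF _ countable_Collect_finite]) auto
    ultimately show ?thesis by (auto intro!: sets.countable_UN')
  qed
  have "(\<lambda>m. prob (N m)) sums prob (\<Union>m. N m)"
    by (rule finite_measure_UNION) (use N in \<open>auto simp: disjoint_family_on_def N_def\<close>)
  moreover have "(\<lambda>m. prob (N m)) sums 1"
    using poisson_weights_sums[of 1 \<mu>] by (simp add: pN)
  ultimately have "prob (\<Union>m. N m) = 1" using sums_unique2 by blast
  then have "AE \<omega> in M. \<omega> \<in> (\<Union>m. N m)" using N by (intro AE_prob_1) auto
  then show ?thesis by (rule AE_mp) (auto simp: N_def)
qed

text \<open>
  Thinning: the obstacles of strength at least \<open>s\<close> in \<open>U\<close> form a Poisson process with the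
  intensity reduced by the factor \<open>1 - p\<close>, and the bound is its void probability. Directly: the
  set \<open>I\<close> of indices of points in \<open>U\<close> is determined by the centres, thus independent of the
  strengths, and given \<open>I\<close> all the strengths are below \<open>s\<close> with probability \<open>p\<close> to the power
  \<open>card I\<close>. Summing over all sets \<open>I\<close> with \<open>m\<close> elements, and then over \<open>m\<close> with the Poisson
  weights, gives the exponential.
\<close>

lemma prob_no_strong_obstacle:
  fixes X :: "nat \<Rightarrow> 'a \<Rightarrow> (real ^ 'n) \<times> real" and s :: real
  assumes od: "obstacle_distribution M lam r1 X f"
    and U: "U \<in> sets borel" "U \<subseteq> UNIV \<times> {r1..}" "emeasure lborel U < \<infinity>"
  defines "p \<equiv> prob {\<omega> \<in> space M. f 0 \<omega> < s}"
  shows "{\<omega> \<in> space M. \<forall>i. X i \<omega> \<in> U \<longrightarrow> f i \<omega> < s} \<in> events"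
    and "prob {\<omega> \<in> space M. \<forall>i. X i \<omega> \<in> U \<longrightarrow> f i \<omega> < s} \<le> exp (- (lam * measure lborel U * (1 - p)))"
proof -
  have X: "poisson_process M lam (UNIV \<times> {r1..}) X" and iv: "indep_vars (\<lambda>_. borel) f UNIV"
    and di: "\<And>k. distr M borel (f k) = distr M borel (f 0)"
    and ind: "indep_set
       (sets (vimage_algebra (space M) (\<lambda>\<omega> k. f k \<omega>) (PiM UNIV (\<lambda>_. borel))))
       (sets (vimage_algebra (space M) (\<lambda>\<omega> k. X k \<omega>) (PiM UNIV (\<lambda>_. borel))))"
    using od by (auto simp: obstacle_distribution_def)
  have [measurable]: "X k \<in> borel_measurable M" for k using X by (simp add: poisson_process_def)
  have [measurable]: "f k \<in> borel_measurable M" for k using iv by (simp add: indep_vars_def)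
  note U(1)[measurable]
  define W where "W = {\<omega> \<in> space M. \<forall>i. X i \<omega> \<in> U \<longrightarrow> f i \<omega> < s}"
  show W: "{\<omega> \<in> space M. \<forall>i. X i \<omega> \<in> U \<longrightarrow> f i \<omega> < s} \<in> events" by measurable
  define N where "N m = {\<omega> \<in> space M. finite {k. X k \<omega> \<in> U} \<and> card {k. X k \<omega> \<in> U} = m}" for m
  define \<mu> where "\<mu> = lam * measure lborel U"
  have pN: "prob (N m) = \<mu> ^ m / fact m * exp (- \<mu>)" for m
    using X U unfolding poisson_process_def N_def \<mu>_def by (simp add: point_count_eq_of_nat)
  define J where "J I = {\<omega> \<in> space M. \<forall>k. (X k \<omega> \<in> U) = (k \<in> I)}" for I
  define G where "G I = {\<omega> \<in> space M. \<forall>k\<in>I. f k \<omega> < s}" for I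
  have J: "J I \<in> events" for I unfolding J_def by measurable
  have G: "G I \<in> events" for I unfolding G_def by measurable
  have pf: "prob (f k -` {..<s} \<inter> space M) = p" for k
  proof -
    have "prob (f k -` {..<s} \<inter> space M) = measure (distr M borel (f k)) {..<s}"
      by (rule measure_distr[symmetric]) auto
    also have "\<dots> = measure (distr M borel (f 0)) {..<s}" by (rule arg_cong[OF di])
    also have "\<dots> = prob (f 0 -` {..<s} \<inter> space M)" by (rule measure_distr) auto
    also have "f 0 -` {..<s} \<inter> space M = {\<omega> \<in> space M. f 0 \<omega> < s}" by auto
    finally show ?thesis by (simp add: p_def)
  qed
  have pG: "prob (G I) = p ^ card I" if "finite I" for I
  proof (cases "I = {}")
    case True
    then show ?thesis by (simp add: G_def prob_space)
  next
    case False
    have "prob (\<Inter>k\<in>I. f k -` {..<s} \<inter> space M) = (\<Prod>k\<in>I. prob (f k -` {..<s} \<inter> space M))"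
      using indep_varsD[OF iv, of I "\<lambda>_. {..<s}"] that False by simp
    moreover have "(\<Inter>k\<in>I. f k -` {..<s} \<inter> space M) = G I"
      using False by (auto simp: G_def)
    ultimately show ?thesis by (simp add: pf)
  qed
  have GJ: "prob (G I \<inter> J I) = p ^ card I * prob (J I)" if "finite I" for I
  proof -
    have eq: "G I = (\<lambda>\<omega> k. f k \<omega>) -` {x \<in> space (PiM UNIV (\<lambda>_. borel)). \<forall>k\<in>I. x k < s} \<inter> space M"
      by (auto simp: G_def space_PiM)
    have m: "{x \<in> space (PiM UNIV (\<lambda>_::nat. borel :: real measure)). \<forall>k\<in>I. x k < s} \<in> sets (PiM UNIV (\<lambda>_. borel))"
      by measurable
    have 1: "G I \<in> sets (vimage_algebra (space M) (\<lambda>\<omega> k. f k \<omega>) (PiM UNIV (\<lambda>_. borel)))"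
      unfolding eq by (rule in_vimage_algebra[OF m])
    have eq': "J I = (\<lambda>\<omega> k. X k \<omega>) -` {x \<in> space (PiM UNIV (\<lambda>_. borel)). \<forall>k. (x k \<in> U) = (k \<in> I)} \<inter> space M"
      by (auto simp: J_def space_PiM)
    have m': "{x \<in> space (PiM UNIV (\<lambda>_::nat. borel :: ((real ^ 'n) \<times> real) measure)). \<forall>k. (x k \<in> U) = (k \<in> I)} \<in> sets (PiM UNIV (\<lambda>_. borel))"
      by measurable
    have 2: "J I \<in> sets (vimage_algebra (space M) (\<lambda>\<omega> k. X k \<omega>) (PiM UNIV (\<lambda>_. borel)))"
      unfolding eq' by (rule in_vimage_algebra[OF m'])
    show ?thesis using indep_setD[OF ind 1 2] pG[OF that] by simp
  qed
  define Fm where "Fm m = {I :: nat set. finite I \<and> card I = m}" for m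
  have Fm: "countable (Fm m)" for m
    by (rule countable_subset[OF _ countable_Collect_finite]) (auto simp: Fm_def)
  have NJ: "N m = (\<Union>I\<in>Fm m. J I)" for m
  proof
    show "N m \<subseteq> (\<Union>I\<in>Fm m. J I)"
    proof
      fix \<omega> assume "\<omega> \<in> N m"
      then show "\<omega> \<in> (\<Union>I\<in>Fm m. J I)"
        by (intro UN_I[of "{k. X k \<omega> \<in> U}"]) (auto simp: N_def J_def Fm_def)
    qed
    show "(\<Union>I\<in>Fm m. J I) \<subseteq> N m" by (auto simp: N_def J_def Fm_def)
  qed
  have N: "N m \<in> events" for m unfolding NJ using Fm J by (intro sets.countable_UN') auto
  have "W \<inter> J I = G I \<inter> J I" for I by (auto simp: W_def G_def J_def)
  then have WN: "W \<inter> N m = (\<Union>I\<in>Fm m. G I \<inter> J I)" for m unfolding NJ by blast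
  have "p \<ge> 0" by (simp add: p_def)
  have disj: "disjoint_family_on J (Fm m)" for m
    unfolding disjoint_family_on_def
  proof (intro ballI impI)
    fix I I' :: "nat set" assume "I \<noteq> I'"
    then show "J I \<inter> J I' = {}" by (auto simp: J_def)
  qed
  have "emeasure M (W \<inter> N m) = ennreal (p ^ m) * emeasure M (N m)" for m
  proof -
    have "emeasure M (W \<inter> N m) = (\<integral>\<^sup>+I. emeasure M (G I \<inter> J I) \<partial>count_space (Fm m))"
      unfolding WN using Fm disj[of m] G J
      by (intro emeasure_UN_countable) (auto simp: disjoint_family_on_def)
    also have "\<dots> = (\<integral>\<^sup>+I. ennreal (p ^ m) * emeasure M (J I) \<partial>count_space (Fm m))"
      using \<open>p \<ge> 0\<close> by (intro nn_integral_cong) (auto simp: Fm_def emeasure_eq_measure GJ ennreal_mult)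
    also have "\<dots> = ennreal (p ^ m) * (\<integral>\<^sup>+I. emeasure M (J I) \<partial>count_space (Fm m))"
      by (intro nn_integral_cmult) auto
    also have "(\<integral>\<^sup>+I. emeasure M (J I) \<partial>count_space (Fm m)) = emeasure M (N m)"
      unfolding NJ using Fm disj J by (intro emeasure_UN_countable[symmetric]) auto
    finally show ?thesis .
  qed
  then have "ennreal (prob (W \<inter> N m)) = ennreal (p ^ m * prob (N m))" for m
    using \<open>p \<ge> 0\<close> by (simp add: emeasure_eq_measure ennreal_mult)
  then have "prob (W \<inter> N m) = p ^ m * prob (N m)" for m
    using \<open>p \<ge> 0\<close> by (simp add: ennreal_inj)
  then have pWN: "prob (W \<inter> N m) = (p * \<mu>) ^ m / fact m * exp (- \<mu>)" for m
    by (simp add: pN power_mult_distrib)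
  have "prob W \<le> prob (\<Union>m. W \<inter> N m)"
  proof (rule finite_measure_mono_AE)
    show "AE \<omega> in M. \<omega> \<in> W \<longrightarrow> \<omega> \<in> (\<Union>m. W \<inter> N m)"
      using AE_finitely_many_points[OF X U] by (rule AE_mp) (auto simp: N_def W_def)
    show "(\<Union>m. W \<inter> N m) \<in> events" using W N by (auto simp: W_def)
  qed
  also have "\<dots> \<le> (\<Sum>m. prob (W \<inter> N m))"
  proof (rule finite_measure_subadditive_countably)
    show "range (\<lambda>m. W \<inter> N m) \<subseteq> events" using W N by (auto simp: W_def)
    show "summable (\<lambda>m. prob (W \<inter> N m))"
      unfolding pWN using poisson_weights_sums by (rule sums_summable)
  qed
  also have "\<dots> = exp (- (\<mu> * (1 - p)))"
    unfolding pWN using poisson_weights_sums by (rule sums_unique[symmetric])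
  finally show "prob {\<omega> \<in> space M. \<forall>i. X i \<omega> \<in> U \<longrightarrow> f i \<omega> < s} \<le> exp (- (lam * measure lborel U * (1 - p)))"
    by (simp add: W_def \<mu>_def)
qed

text \<open>
  Continuity of the measure: the events \<open>g < 1/(n+1)\<close> decrease to a null set.
\<close>

lemma exists_strength_threshold:
  fixes g :: "'a \<Rightarrow> real"
  assumes [measurable]: "g \<in> borel_measurable M" and pos: "AE \<omega> in M. 0 < g \<omega>"
  shows "\<exists>s>0. prob {\<omega> \<in> space M. g \<omega> < s} \<le> 1 / 2"
proof -
  define A where "A n = {\<omega> \<in> space M. g \<omega> < 1 / real (Suc n)}" for n
  have "(\<lambda>n. prob (A n)) \<longlonglongrightarrow> prob (\<Inter>n. A n)"
  proof (rule finite_Lim_measure_decseq)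
    show "range A \<subseteq> events" by (auto simp: A_def)
    show "decseq A"
    proof (rule decseq_SucI, rule subsetI)
      fix n x assume "x \<in> A (Suc n)"
      moreover have "1 / real (Suc (Suc n)) \<le> 1 / real (Suc n)" by (intro frac_le) auto
      ultimately show "x \<in> A n" unfolding A_def by (auto intro: less_le_trans)
    qed
  qed
  moreover have "prob (\<Inter>n. A n) = 0"
  proof -
    have "AE \<omega> in M. \<omega> \<notin> (\<Inter>n. A n)"
      using pos
    proof (rule AE_mp, intro AE_I2 impI)
      fix \<omega> assume "0 < g \<omega>"
      then obtain n where "1 / real (Suc n) < g \<omega>" using nat_approx_posE by metis
      then show "\<omega> \<notin> (\<Inter>n. A n)" by (auto simp: A_def intro!: exI[of _ n])
    qed
    then show ?thesis by (subst prob_eq_0) (auto simp: A_def)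
  qed
  ultimately have "\<forall>\<^sub>F n in sequentially. prob (A n) < 1 / 2"
    by (intro order_tendstoD(2)[of _ 0]) auto
  then obtain n where "prob (A n) < 1 / 2" by (metis eventually_happens' sequentially_bot)
  then show ?thesis by (intro exI[of _ "1 / real (Suc n)"]) (auto simp: A_def)
qed

lemma AE_locally_finite:
  fixes X :: "nat \<Rightarrow> 'a \<Rightarrow> (real ^ 'n) \<times> real"
  assumes X: "poisson_process M lam (UNIV \<times> {r1..}) X"
  shows "AE \<omega> in M. \<forall>r. finite {k. norm (X k \<omega>) \<le> r}"
proof -
  have cl: "closed ((UNIV :: (real ^ 'n) set) \<times> {r1..})" by (intro closed_Times) auto
  have "AE \<omega> in M. \<forall>n::nat. finite {k. X k \<omega> \<in> cball 0 (real n) \<inter> (UNIV \<times> {r1..})}"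
    unfolding AE_all_countable
  proof
    fix n :: nat
    have "emeasure lborel (cball (0 :: (real ^ 'n) \<times> real) (real n) \<inter> (UNIV \<times> {r1..})) < \<infinity>"
      using cl by (intro emeasure_bounded_finite bounded_Int) auto
    then show "AE \<omega> in M. finite {k. X k \<omega> \<in> cball 0 (real n) \<inter> (UNIV \<times> {r1..})}"
      using cl by (intro AE_finitely_many_points[OF X]) auto
  qed
  then show ?thesis
  proof (rule AE_mp, intro AE_I2 impI allI)
    fix \<omega> r assume w: "\<omega> \<in> space M" and a: "\<forall>n::nat. finite {k. X k \<omega> \<in> cball 0 (real n) \<inter> (UNIV \<times> {r1..})}"
    obtain n where "r \<le> real n" using real_arch_simple by blast
    moreover have "X k \<omega> \<in> UNIV \<times> {r1..}" for k using X w by (auto simp: poisson_process_def)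
    ultimately have "{k. norm (X k \<omega>) \<le> r} \<subseteq> {k. X k \<omega> \<in> cball 0 (real n) \<inter> (UNIV \<times> {r1..})}" by auto
    then show "finite {k. norm (X k \<omega>) \<le> r}" using a finite_subset by blast
  qed
qed

end

section \<open>A Lipschitz surface of strong obstacles\<close>

text \<open>
  The cell over column \<open>k\<close> at height \<open>j\<close>. Boxes are open, so that distinct cells are disjoint.
\<close>

definition cell :: "real \<Rightarrow> real \<Rightarrow> real \<Rightarrow> (int ^ 'n) \<times> nat \<Rightarrow> ((real ^ 'n) \<times> real) set" where
  "cell l h r1 = (\<lambda>(k, j). box ((\<chi> i. l * real_of_int (k $ i)), r1 + h * real j)
     ((\<chi> i. l * (real_of_int (k $ i) + 1)), r1 + h * (real j + 1)))"

lemma mem_box_Pair: "(x, y) \<in> box (a, c) (b, d) \<longleftrightarrow> x \<in> box a b \<and> y \<in> box c d"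
  by (auto simp: mem_box Basis_prod_def ball_Un)

lemma cell_iff:
  "(x, y) \<in> cell l h r1 (k, j) \<longleftrightarrow>
     (\<forall>i. l * real_of_int (k $ i) < x $ i \<and> x $ i < l * (real_of_int (k $ i) + 1)) \<and>
     r1 + h * real j < y \<and> y < r1 + h * (real j + 1)"
  by (simp add: cell_def mem_box_Pair mem_box_cart)

lemma measure_cell:
  assumes "l > 0" "h > 0"
  shows "measure lborel (cell l h r1 z :: ((real ^ 'n) \<times> real) set) = l ^ CARD('n) * h"
proof (cases z)
  case (Pair k j)
  define a b where "a = (\<chi> i. l * real_of_int (k $ i))" and "b = (\<chi> i. l * (real_of_int (k $ i) + 1))"
  have "cbox a b \<noteq> {}" using assms by (auto simp: a_def b_def interval_ne_empty_cart)
  then have "measure lborel (cbox a b) = l ^ CARD('n)"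
    by (subst content_cbox_cart) (auto simp: a_def b_def algebra_simps)
  moreover have "measure lborel (cbox (r1 + h * real j) (r1 + h * (real j + 1))) = h"
    using assms by (simp add: algebra_simps)
  ultimately show ?thesis
    using content_Pair[of a "r1 + h * real j" b "r1 + h * (real j + 1)"]
    by (simp only: Pair cell_def prod.case a_def[symmetric] b_def[symmetric]
        measure_lborel_box_eq measure_lborel_cbox_eq)
qed

lemma cell_unique:
  assumes "l > 0" "h > 0" "(x, y) \<in> cell l h r1 (k, j)"
  shows "k = (\<chi> i. \<lfloor>x $ i / l\<rfloor>)" "j = nat \<lfloor>(y - r1) / h\<rfloor>"
proof -
  have "\<lfloor>x $ i / l\<rfloor> = k $ i" for i
    using assms by (intro floor_unique) (auto simp: cell_iff field_simps less_imp_le)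
  then show "k = (\<chi> i. \<lfloor>x $ i / l\<rfloor>)" by (simp add: vec_eq_iff)
  have "\<lfloor>(y - r1) / h\<rfloor> = int j"
    using assms by (intro floor_unique) (auto simp: cell_iff field_simps less_imp_le)
  then show "j = nat \<lfloor>(y - r1) / h\<rfloor>" by simp
qed

text \<open>
  A finite set of disjoint cells without strong obstacles is one region without strong obstacles,
  whose void probability is the product of those of the cells. So the hypothesis of the
  percolation estimate holds with \<open>q\<close> equal to the bound for a single cell.
\<close>

lemma (in prob_space) AE_obstacle_surface:
  fixes X :: "nat \<Rightarrow> 'a \<Rightarrow> (real ^ 'n) \<times> real"
  assumes od: "obstacle_distribution M lam r1 X f"
    and s: "prob {\<omega> \<in> space M. f 0 \<omega> < s} \<le> 1 / 2"
    and l: "l > 0" "h > 0"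
    and q: "(2 * (real (card {e :: int ^ 'n. \<forall>i. \<bar>e $ i\<bar> \<le> 1}) + 1))\<^sup>2 * exp (- (lam * (l ^ CARD('n) * h) / 2)) \<le> 1"
  shows "AE \<omega> in M. \<exists>H :: int ^ 'n \<Rightarrow> nat.
    (\<forall>k. \<exists>i. X i \<omega> \<in> cell l h r1 (k, H k) \<and> s \<le> f i \<omega>) \<and>
    (\<forall>m k k'. (\<forall>i. \<bar>k $ i - k' $ i\<bar> \<le> int m) \<longrightarrow> H k \<le> H k' + m)"
proof -
  define C where "C \<omega> z \<longleftrightarrow> (\<forall>i. X i \<omega> \<in> cell l h r1 z \<longrightarrow> f i \<omega> < s)" for \<omega> z
  define q where "q = exp (- (lam * (l ^ CARD('n) * h) / 2))"
  have lam: "lam > 0" using od by (simp add: obstacle_distribution_def)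
  have sub: "cell l h r1 z \<subseteq> UNIV \<times> {r1..}" for z :: "(int ^ 'n) \<times> nat"
  proof
    fix w assume "w \<in> cell l h r1 z"
    moreover obtain x y k j where w: "w = (x, y)" "z = (k, j)" by (cases w, cases z) auto
    ultimately have "r1 + h * real j < y" by (simp add: cell_iff)
    moreover have "0 \<le> h * real j" using l by simp
    ultimately have "r1 \<le> y" by linarith
    then show "w \<in> UNIV \<times> {r1..}" by (simp add: w)
  qed
  have bor: "cell l h r1 z \<in> sets borel" for z :: "(int ^ 'n) \<times> nat"
    by (cases z) (simp add: cell_def)
  have fin: "emeasure lborel (cell l h r1 z) < \<infinity>" for z :: "(int ^ 'n) \<times> nat"
    using emeasure_lborel_box_finite by (cases z) (simp add: cell_def)
  have disj: "disjoint_family (cell l h r1 :: (int ^ 'n) \<times> nat \<Rightarrow> _)"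
    unfolding disjoint_family_on_def
  proof (intro ballI impI)
    fix z z' :: "(int ^ 'n) \<times> nat" assume ne: "z \<noteq> z'"
    have "z = z'" if "w \<in> cell l h r1 z" "w \<in> cell l h r1 z'" for w
    proof -
      obtain x y k j k' j' where w: "w = (x, y)" "z = (k, j)" "z' = (k', j')"
        by (cases w, cases z, cases z') auto
      note u = cell_unique[OF l that(1)[unfolded w]] cell_unique[OF l that(2)[unfolded w]]
      show ?thesis unfolding w using u(1,3) u(2,4) by metis
    qed
    then show "cell l h r1 z \<inter> cell l h r1 z' = {}" using ne by blast
  qed
  have closed: "{\<omega> \<in> space M. \<forall>z\<in>S. C \<omega> z} \<in> events" "prob {\<omega> \<in> space M. \<forall>z\<in>S. C \<omega> z} \<le> q ^ card S"
    if "finite S" for S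
  proof -
    define U where "U = (\<Union>z\<in>S. cell l h r1 z)"
    have U: "U \<in> sets borel" "U \<subseteq> UNIV \<times> {r1..}" "emeasure lborel U < \<infinity>"
    proof -
      show "U \<in> sets borel" unfolding U_def using bor that by (intro sets.finite_UN) auto
      show "U \<subseteq> UNIV \<times> {r1..}" unfolding U_def using sub by blast
      have "bounded (cell l h r1 z)" for z :: "(int ^ 'n) \<times> nat" by (cases z) (simp add: cell_def bounded_box)
      then show "emeasure lborel U < \<infinity>"
        unfolding U_def using that by (intro emeasure_bounded_finite bounded_UN) auto
    qed
    have "measure lborel U = (\<Sum>z\<in>S. measure lborel (cell l h r1 z))"
      unfolding U_def
    proof (rule measure_finite_Union[OF that])
      show "disjoint_family_on (cell l h r1) S" by (rule disjoint_family_on_mono[OF _ disj]) simp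
      show "emeasure lborel (cell l h r1 z) \<noteq> \<infinity>" for z :: "(int ^ 'n) \<times> nat"
        using fin[of z] by simp
    qed (use bor in auto)
    then have mU: "measure lborel U = real (card S) * (l ^ CARD('n) * h)"
      by (simp add: measure_cell[OF l])
    have eq: "{\<omega> \<in> space M. \<forall>z\<in>S. C \<omega> z} = {\<omega> \<in> space M. \<forall>i. X i \<omega> \<in> U \<longrightarrow> f i \<omega> < s}"
      unfolding U_def C_def by auto
    show "{\<omega> \<in> space M. \<forall>z\<in>S. C \<omega> z} \<in> events"
      unfolding eq by (rule prob_no_strong_obstacle(1)[OF od U])
    have "prob {\<omega> \<in> space M. \<forall>z\<in>S. C \<omega> z} \<le> exp (- (lam * measure lborel U * (1 - prob {\<omega> \<in> space M. f 0 \<omega> < s})))"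
      unfolding eq by (rule prob_no_strong_obstacle(2)[OF od U])
    also have "\<dots> \<le> exp (- (lam * measure lborel U * (1 / 2)))"
    proof -
      have "lam * measure lborel U * (1 / 2) \<le> lam * measure lborel U * (1 - prob {\<omega> \<in> space M. f 0 \<omega> < s})"
        using s lam by (intro mult_left_mono) auto
      then show ?thesis by simp
    qed
    also have "\<dots> = q ^ card S"
      unfolding q_def mU by (simp add: exp_of_nat_mult[symmetric] algebra_simps)
    finally show "prob {\<omega> \<in> space M. \<forall>z\<in>S. C \<omega> z} \<le> q ^ card S" .
  qed
  define E where "E = {e :: int ^ 'n. \<forall>i. \<bar>e $ i\<bar> \<le> 1}"
  have "AE \<omega> in M. \<exists>j. \<not> reach E (C \<omega>) k j" for k
  proof (rule AE_not_reach)
    show "finite E" unfolding E_def by (rule finite_bounded_lattice)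
    show "{\<omega> \<in> space M. C \<omega> z} \<in> events" for z using closed(1)[of "{z}"] by simp
    show "(2 * (real (card E) + 1))\<^sup>2 * q \<le> 1" "0 \<le> q" using assms(5) by (simp_all add: E_def q_def)
    show "prob {\<omega> \<in> space M. \<forall>z\<in>S. C \<omega> z} \<le> q ^ card S" if "finite S" for S using closed(2)[OF that] .
  qed
  then have "AE \<omega> in M. \<forall>k. \<exists>j. \<not> reach E (C \<omega>) k j" by (simp add: AE_all_countable)
  then show ?thesis
  proof (rule AE_mp, intro AE_I2 impI)
    fix \<omega> assume "\<forall>k. \<exists>j. \<not> reach E (C \<omega>) k j"
    then obtain H where "\<forall>k. \<not> C \<omega> (k, H k)" 
      "\<forall>m k k'. (\<forall>i. \<bar>k $ i - k' $ i\<bar> \<le> int m) \<longrightarrow> H k \<le> H k' + m"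
      using lipschitz_surface[of "C \<omega>"] unfolding E_def by blast
    then show "\<exists>H :: int ^ 'n \<Rightarrow> nat.
      (\<forall>k. \<exists>i. X i \<omega> \<in> cell l h r1 (k, H k) \<and> s \<le> f i \<omega>) \<and>
      (\<forall>m k k'. (\<forall>i. \<bar>k $ i - k' $ i\<bar> \<le> int m) \<longrightarrow> H k \<le> H k' + m)"
      by (intro exI[of _ H]) (auto simp: C_def not_less)
  qed
qed

section \<open>The radial profile\<close>

text \<open>
  The second term regularises the power \<open>\<bar>z\<bar>\<^sup>-\<^sup>2\<^sup>s\<close>, which is superharmonic for \<open>2 s > n - 2\<close>
  (the fundamental solution is the case \<open>2 s = n - 2\<close>).
\<close>

definition profile :: "real \<Rightarrow> real \<Rightarrow> real \<Rightarrow> real \<Rightarrow> 'a::euclidean_space \<Rightarrow> real" where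
  "profile B A a s z = B * (z \<bullet> z) - A * (z \<bullet> z + a) powr (- s)"

text \<open>
  The explicit form of the Laplacian of the profile, arranged so that the sign of the second
  summand can be read off.
\<close>

definition profile_laplacian :: "real \<Rightarrow> real \<Rightarrow> real \<Rightarrow> real \<Rightarrow> 'a::euclidean_space \<Rightarrow> real" where
  "profile_laplacian B A a s z = 2 * real DIM('a) * B +
     2 * A * s * (z \<bullet> z + a) powr (- s - 2) * (real DIM('a) * a - (2 * (s + 1) - real DIM('a)) * (z \<bullet> z))"

lemma powr_split: "x > 0 \<Longrightarrow> x powr (- s - 1) = x powr (- s - 2) * x" for x s :: real
proof -
  assume "x > 0"
  have "- s - 1 = (- s - 2) + 1" by simp
  then have "x powr (- s - 1) = x powr (- s - 2) * x powr 1" by (simp only: powr_add)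
  then show ?thesis using \<open>x > 0\<close> by simp
qed

lemma continuous_on_profile: "a > 0 \<Longrightarrow> continuous_on S (profile B A a s)"
  unfolding profile_def[abs_def]
  by (auto intro!: continuous_intros simp: add_nonneg_pos add_nonneg_eq_0_iff)

lemma second_difference_profile:
  fixes K :: "'a::euclidean_space set"
  assumes a: "a > 0" and K: "compact K" and \<eta>: "\<eta> > 0"
  shows "\<forall>\<^sub>F h in at_right 0. \<forall>z\<in>K.
    \<bar>(\<Sum>b\<in>Basis. profile B A a s (z + h *\<^sub>R b) + profile B A a s (z - h *\<^sub>R b) - 2 * profile B A a s z)
      - h\<^sup>2 * profile_laplacian B A a s z\<bar> \<le> \<eta> * h\<^sup>2"
proof -
  define G1 where "G1 t = B + A * s * (t + a) powr (- s - 1)" for t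
  define G2 where "G2 t = - (A * s * (s + 1) * (t + a) powr (- s - 2))" for t
  define P where "P b z = 2 * G1 (z \<bullet> z) * (z \<bullet> b)" for b z :: 'a
  define Q where "Q b z = 4 * G2 (z \<bullet> z) * (z \<bullet> b)\<^sup>2 + 2 * G1 (z \<bullet> z)" for b z :: 'a
  have pos: "z \<bullet> z + a > 0" for z :: 'a using a by (simp add: add_nonneg_pos)
  have nrm: "((\<lambda>t. (z + t *\<^sub>R b) \<bullet> (z + t *\<^sub>R b)) has_real_derivative 2 * (z \<bullet> b)) (at 0)" for z b :: 'a
  proof -
    have "((\<lambda>t. z \<bullet> z + 2 * t * (z \<bullet> b) + t\<^sup>2 * (b \<bullet> b)) has_real_derivative 2 * (z \<bullet> b)) (at 0)"
      by (auto intro!: derivative_eq_intros)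
    moreover have "(\<lambda>t. z \<bullet> z + 2 * t * (z \<bullet> b) + t\<^sup>2 * (b \<bullet> b)) = (\<lambda>t. (z + t *\<^sub>R b) \<bullet> (z + t *\<^sub>R b))"
      by (auto simp: algebra_simps inner_commute power2_eq_square)
    ultimately show ?thesis by simp
  qed
  have pw: "((\<lambda>t. ((z + t *\<^sub>R b) \<bullet> (z + t *\<^sub>R b) + a) powr r) has_real_derivative
      r * (z \<bullet> z + a) powr (r - 1) * (2 * (z \<bullet> b))) (at 0)" for z b :: 'a and r
    by (rule derivative_eq_intros refl nrm | use pos[of z] in simp)+
  have lap: "(\<Sum>b\<in>Basis. Q b z) = profile_laplacian B A a s z" for z :: 'a
  proof -
    have "(\<Sum>b\<in>Basis. Q b z) = 4 * G2 (z \<bullet> z) * (\<Sum>b\<in>Basis. (z \<bullet> b)\<^sup>2) + real DIM('a) * (2 * G1 (z \<bullet> z))"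
      by (simp add: Q_def sum.distrib sum_distrib_left)
    also have "(\<Sum>b\<in>Basis. (z \<bullet> b)\<^sup>2) = z \<bullet> z"
      by (simp add: euclidean_inner[of z z] power2_eq_square)
    also have "(z \<bullet> z + a) powr (- s - 1) = (z \<bullet> z + a) powr (- s - 2) * (z \<bullet> z + a)"
      by (rule powr_split[OF pos])
    then have "4 * G2 (z \<bullet> z) * (z \<bullet> z) + real DIM('a) * (2 * G1 (z \<bullet> z)) = profile_laplacian B A a s z"
      by (simp add: G1_def G2_def profile_laplacian_def algebra_simps)
    finally show ?thesis .
  qed
  have "\<forall>\<^sub>F h in at_right 0. \<forall>z\<in>K.
    \<bar>(\<Sum>b\<in>Basis. profile B A a s (z + h *\<^sub>R b) + profile B A a s (z - h *\<^sub>R b) - 2 * profile B A a s z)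
      - h\<^sup>2 * (\<Sum>b\<in>Basis. Q b z)\<bar> \<le> \<eta> * h\<^sup>2"
  proof (rule second_difference_approx[where P=P, OF _ _ _ K \<eta>])
    fix z b :: 'a assume b: "b \<in> Basis"
    show "((\<lambda>t. profile B A a s (z + t *\<^sub>R b)) has_real_derivative P b z) (at 0)"
      unfolding profile_def P_def G1_def
      by (rule derivative_eq_intros refl nrm pw)+ (simp add: algebra_simps)
    have lin: "((\<lambda>t. (z + t *\<^sub>R b) \<bullet> b) has_real_derivative 1) (at 0)"
      using b by (auto intro!: derivative_eq_intros simp: inner_add_left inner_Basis)
    show "((\<lambda>t. P b (z + t *\<^sub>R b)) has_real_derivative Q b z) (at 0)"
      unfolding Q_def P_def G1_def G2_def
      by (rule derivative_eq_intros refl nrm pw lin)+ (simp add: algebra_simps power2_eq_square)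
  next
    fix b :: 'a
    show "continuous_on UNIV (Q b)"
      unfolding Q_def[abs_def] G1_def G2_def
      using pos by (auto intro!: continuous_intros simp: less_imp_neq[symmetric])
  qed
  then show ?thesis by (simp add: lap)
qed

lemma profile_laplacian_le_core:
  fixes z :: "'a::euclidean_space"
  assumes "a > 0" "A \<ge> 0" "s > 0" "2 * (s + 1) \<ge> real DIM('a)"
  shows "profile_laplacian B A a s z \<le> 2 * real DIM('a) * B + 2 * A * s * real DIM('a) * a powr (- s - 1)"
proof -
  have "(z \<bullet> z + a) powr (- s - 2) * (real DIM('a) * a - (2 * (s + 1) - real DIM('a)) * (z \<bullet> z))
     \<le> (z \<bullet> z + a) powr (- s - 2) * (real DIM('a) * a)"
    using assms by (intro mult_left_mono) auto
  also have "\<dots> \<le> a powr (- s - 2) * (real DIM('a) * a)"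
    using assms by (intro mult_right_mono powr_mono2') auto
  also have "\<dots> = real DIM('a) * a powr (- s - 1)"
    using powr_split[OF assms(1), of s] by simp
  finally have "2 * A * s * ((z \<bullet> z + a) powr (- s - 2) * (real DIM('a) * a - (2 * (s + 1) - real DIM('a)) * (z \<bullet> z)))
     \<le> 2 * A * s * (real DIM('a) * a powr (- s - 1))"
    using assms by (intro mult_left_mono) auto
  then show ?thesis by (simp add: profile_laplacian_def algebra_simps)
qed

text \<open>
  With \<open>n\<close> the dimension, for \<open>2 (s + 1) = n + 3/2\<close> and \<open>n a = 3/4 r\<^sup>2\<close> the last factor of \<open>profile_laplacian\<close> is
  \<open>3/4 r\<^sup>2 - 3/2 \<bar>z\<bar>\<^sup>2 \<le> - 3/4 \<bar>z\<bar>\<^sup>2\<close>, so the power law loses a definite amount up to the radius \<open>R\<close>.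
\<close>

lemma profile_laplacian_le_annulus:
  fixes z :: "'a::euclidean_space"
  assumes "a > 0" "A \<ge> 0" "s > 0" and s: "2 * (s + 1) = real DIM('a) + 3 / 2"
    and a: "real DIM('a) * a = 3 / 4 * r\<^sup>2"
    and z: "r\<^sup>2 \<le> z \<bullet> z" "z \<bullet> z \<le> R\<^sup>2"
  shows "profile_laplacian B A a s z \<le> 2 * real DIM('a) * B - 3 / 4 * A * s * (2 * R\<^sup>2) powr (- s - 1)"
proof -
  have az: "a \<le> z \<bullet> z"
  proof -
    have "a \<le> real DIM('a) * a" using assms(1) by (simp add: Suc_le_eq)
    also have "\<dots> \<le> r\<^sup>2" using a zero_le_power2[of r] by linarith
    finally show ?thesis using z by simp
  qed
  define p where "p = 3 / 2 * (z \<bullet> z) - 3 / 4 * r\<^sup>2"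
  define D where "D = z \<bullet> z + a"
  have D: "D > 0" "D \<le> 2 * (z \<bullet> z)" "D \<le> 2 * R\<^sup>2" using az z assms(1) by (auto simp: D_def add_nonneg_pos)
  have "3 / 8 * (2 * R\<^sup>2) powr (- s - 1) \<le> 3 / 8 * D powr (- s - 1)"
    using D assms by (intro mult_left_mono powr_mono2') auto
  also have "\<dots> = D powr (- s - 2) * (3 / 8 * D)"
    using powr_split[OF D(1), of s] by simp
  also have "\<dots> \<le> D powr (- s - 2) * p"
    using D z by (intro mult_left_mono) (auto simp: p_def)
  finally have "2 * A * s * (3 / 8 * (2 * R\<^sup>2) powr (- s - 1))
      \<le> 2 * A * s * (D powr (- s - 2) * p)"
    using assms by (intro mult_left_mono) auto
  moreover have "real DIM('a) * a - (2 * (s + 1) - real DIM('a)) * (z \<bullet> z) = - p"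
    unfolding s a p_def by simp
  then have "profile_laplacian B A a s z =
      2 * real DIM('a) * B - 2 * A * s * (D powr (- s - 2) * p)"
    unfolding profile_laplacian_def D_def by (simp add: mult.assoc)
  ultimately show ?thesis by simp
qed

text \<open>
  All constants are chosen here. \<open>A\<close> depends only on \<open>\<theta>\<close>, \<open>r0\<close> and the dimension \<open>N\<close>; it is so
  small that the profile stays within the obstacle's core and that its Laplacian there is
  absorbed by the force \<open>\<theta>\<close>. With \<open>R\<close> proportional to \<open>l\<close>, the function \<open>g\<close> below is the
  superharmonicity available on the annulus between \<open>r0\<close> and \<open>R\<close>; half of it is spent on the
  quadratic term and a quarter is the force \<open>F\<close>, leaving a margin of \<open>F\<close> for the passage
  to second differences. In the last conclusion \<open>z'\<close> is the position relative to the obstacle of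
  the own column and \<open>z\<close> that relative to a distant one: the difference of the profiles exceeds
  the largest possible difference of the obstacle heights.
\<close>

lemma exists_obstacle_profile:
  fixes \<theta> r0 V :: real
  assumes \<theta>: "\<theta> > 0" and r0: "r0 > 0" and V: "V > 0"
  obtains l h R F and W :: "'a::euclidean_space \<Rightarrow> real" where
    "l > 0" "h > 0" "l ^ DIM('a) * h = V" "F > 0"
    "continuous_on UNIV W"
    "\<And>z. - r0 \<le> W z"
    "\<And>z. norm z \<le> r0 \<Longrightarrow> \<bar>W z\<bar> \<le> r0"
    "\<forall>\<^sub>F e in at_right 0. \<forall>z\<in>cball 0 R.
       (\<Sum>b\<in>Basis. W (z + e *\<^sub>R b) + W (z - e *\<^sub>R b) - 2 * W z) \<le> ((if norm z \<le> r0 then \<theta> else 0) - F) * e\<^sup>2"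
    "\<And>z z'. norm z' \<le> sqrt (real DIM('a)) * l \<Longrightarrow> norm z \<ge> R \<Longrightarrow> W z' + h * (2 + norm z / l) < W z"
proof -
  define N where "N = real DIM('a)"
  have N: "N \<ge> 1" by (simp add: N_def Suc_le_eq)
  define s where "s = N / 2 - 1 / 4"
  define a where "a = 3 / 4 * r0\<^sup>2 / N"
  have s: "s > 0" using N by (simp add: s_def)
  have a: "a > 0" using r0 N by (simp add: a_def)
  define A where "A = min (\<theta> / (16 * s * N) * a powr (s + 1)) (r0 / 2 * a powr s)"
  have A: "A > 0" using \<theta> s N a r0 by (simp add: A_def)
  define c where "c = 3 / 4 * A * s * (8 * N) powr (- s - 1)"
  have c: "c > 0" using A s N by (simp add: c_def)
  define g where "g l = c * l powr (- N - 3 / 2)" for l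
  have g0: "(g \<longlongrightarrow> 0) at_top"
  proof -
    have "((\<lambda>l::real. l powr (- N - 3 / 2)) \<longlongrightarrow> 0) at_top"
      using N by (intro tendsto_neg_powr filterlim_ident) auto
    then show ?thesis unfolding g_def by (rule tendsto_mult_right_zero)
  qed
  \<comment> \<open>These bounds on \<open>l\<close> say, in this order: the core absorbs the Laplacian, the quadratic term
    stays below \<open>r0 / 2\<close> in the core, and \<open>2 h \<le> B l\<^sup>2\<close>.\<close>
  have "\<forall>\<^sub>F l in at_top. g l < \<theta> / 2" "\<forall>\<^sub>F l in at_top. g l < 2 * N / r0"
    by (rule order_tendstoD(2)[OF g0], use \<theta> N r0 in simp)+
  moreover have "\<forall>\<^sub>F l in at_top. 8 * N * V / c < sqrt l"
    using sqrt_at_top by (auto simp: filterlim_at_top_dense)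
  moreover have "\<forall>\<^sub>F l::real in at_top. l > 0" by (rule eventually_gt_at_top)
  ultimately have "\<forall>\<^sub>F l in at_top. g l < \<theta> / 2 \<and> g l < 2 * N / r0 \<and> 8 * N * V / c < sqrt l \<and> l > 0"
    by eventually_elim auto
  then obtain l where l: "g l < \<theta> / 2" "g l < 2 * N / r0" "8 * N * V / c < sqrt l" "l > 0"
    using eventually_happens'[OF trivial_limit_at_top_linorder] by blast
  define h where "h = V / l ^ DIM('a)"
  define B where "B = g l / (4 * N)"
  define R where "R = 2 * sqrt N * l"
  define F where "F = g l / 4"
  define W where "W = (profile B A a s :: 'a \<Rightarrow> real)"
  have gp: "g l > 0" using c l by (simp add: g_def)
  have B: "B > 0" using gp N by (simp add: B_def)
  have h: "h > 0" using V l by (simp add: h_def)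
  have hl: "2 * h \<le> B * l\<^sup>2"
  proof -
    have "l powr (- N - 3 / 2) * l powr 2 * l powr N = l powr (1 / 2)"
      by (simp add: powr_add[symmetric])
    then have "g l * l\<^sup>2 * l ^ DIM('a) = c * sqrt l"
      using l powr_realpow[OF l(4), of "DIM('a)"] powr_realpow[OF l(4), of 2]
      by (simp add: g_def N_def powr_half_sqrt mult.assoc)
    moreover have "8 * N * V \<le> c * sqrt l" using l c by (simp add: field_simps)
    ultimately have "2 * V \<le> B * l\<^sup>2 * l ^ DIM('a)" using N by (simp add: B_def field_simps)
    then show ?thesis using l by (simp add: h_def field_simps)
  qed
  have Apow: "A * (z \<bullet> z + a) powr (- s) \<le> r0 / 2" for z :: 'a
  proof -
    have "A * (z \<bullet> z + a) powr (- s) \<le> A * a powr (- s)"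
      using A a s by (intro mult_left_mono powr_mono2') auto
    also have "\<dots> \<le> (r0 / 2 * a powr s) * a powr (- s)"
      by (intro mult_right_mono) (auto simp: A_def)
    also have "\<dots> = r0 / 2" using a by (simp add: powr_minus)
    finally show ?thesis .
  qed
  have Apow0: "0 \<le> A * (z \<bullet> z + a) powr (- s)" for z :: 'a using A by simp
  have R2: "2 * R\<^sup>2 = 8 * N * l\<^sup>2" using N by (simp add: R_def power_mult_distrib)
  have gR: "3 / 4 * A * s * (2 * R\<^sup>2) powr (- s - 1) = g l"
  proof -
    have "(l\<^sup>2) powr (- s - 1) = l powr (- N - 3 / 2)"
    proof -
      have "(l\<^sup>2) powr (- s - 1) = (l powr 2) powr (- s - 1)" using powr_realpow[OF l(4), of 2] by simp
      also have "\<dots> = l powr (- N - 3 / 2)" by (simp only: powr_powr) (simp add: s_def algebra_simps)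
      finally show ?thesis .
    qed
    then show ?thesis unfolding R2 using N by (simp add: powr_mult g_def c_def)
  qed
  have s2: "2 * (s + 1) = real DIM('a) + 3 / 2" by (simp add: s_def N_def)
  have lap: "profile_laplacian B A a s z \<le> (if norm z \<le> r0 then \<theta> else 0) - 2 * F"
    if "norm z \<le> R" for z :: 'a
  proof -
    have NB: "2 * real DIM('a) * B = g l / 2" using N by (simp add: B_def N_def)
    show ?thesis
    proof (cases "norm z \<le> r0")
      case True
      have "profile_laplacian B A a s z \<le> 2 * real DIM('a) * B + 2 * A * s * real DIM('a) * a powr (- s - 1)"
        using a A s s2 by (intro profile_laplacian_le_core) auto
      also have "2 * A * s * real DIM('a) * a powr (- s - 1) \<le>
          2 * (\<theta> / (16 * s * N) * a powr (s + 1)) * s * real DIM('a) * a powr (- s - 1)"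
        using s by (intro mult_right_mono mult_left_mono) (auto simp: A_def)
      also have "\<dots> = \<theta> / 8 * (a powr (s + 1) * a powr (- s - 1))"
        using s N by (simp add: N_def[symmetric])
      also have "a powr (s + 1) * a powr (- s - 1) = 1" using a by (simp add: powr_add[symmetric])
      finally show ?thesis using True l \<theta> by (simp add: NB F_def)
    next
      case False
      have "r0\<^sup>2 \<le> z \<bullet> z" "z \<bullet> z \<le> R\<^sup>2"
        using False that r0 by (auto simp: power2_norm_eq_inner[symmetric] intro!: power_mono)
      then have "profile_laplacian B A a s z \<le> 2 * real DIM('a) * B - 3 / 4 * A * s * (2 * R\<^sup>2) powr (- s - 1)"
        using a A s s2 N by (intro profile_laplacian_le_annulus[where r=r0]) (auto simp: a_def N_def)
      then show ?thesis unfolding gR NB using False by (simp add: F_def)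
    qed
  qed
  show ?thesis
  proof (rule that)
    show "l > 0" "h > 0" by fact+
    show "l ^ DIM('a) * h = V" using l by (simp add: h_def)
    show "F > 0" using gp by (simp add: F_def)
    show "continuous_on UNIV W" unfolding W_def using a by (rule continuous_on_profile)
    show "- r0 \<le> W z" for z
    proof -
      have "0 \<le> B * (z \<bullet> z)" using B by simp
      then show ?thesis using Apow[of z] r0 by (simp add: W_def profile_def)
    qed
    show "\<bar>W z\<bar> \<le> r0" if "norm z \<le> r0" for z
    proof -
      have "z \<bullet> z \<le> r0\<^sup>2" using that by (simp add: power2_norm_eq_inner[symmetric] power_mono)
      then have "B * (z \<bullet> z) \<le> B * r0\<^sup>2" using B by simp
      also have "\<dots> \<le> r0 / 2" using l N r0 by (simp add: B_def field_simps power2_eq_square)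
      finally have "B * (z \<bullet> z) \<le> r0 / 2" .
      moreover have "0 \<le> B * (z \<bullet> z)" using B by simp
      ultimately show ?thesis using Apow[of z] Apow0[of z] r0 by (simp add: W_def profile_def)
    qed
    have "F > 0" using gp by (simp add: F_def)
    from second_difference_profile[OF a compact_cball this, of 0 R B A s]
    show "\<forall>\<^sub>F e in at_right 0. \<forall>z\<in>cball 0 R.
       (\<Sum>b\<in>Basis. W (z + e *\<^sub>R b) + W (z - e *\<^sub>R b) - 2 * W z) \<le> ((if norm z \<le> r0 then \<theta> else 0) - F) * e\<^sup>2"
    proof (rule eventually_mono, intro ballI)
      fix e :: real and z :: 'a
      assume *: "\<forall>z\<in>cball (0 :: 'a) R. \<bar>(\<Sum>b\<in>Basis. profile B A a s (z + e *\<^sub>R b) + profile B A a s (z - e *\<^sub>R b)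
        - 2 * profile B A a s z) - e\<^sup>2 * profile_laplacian B A a s z\<bar> \<le> F * e\<^sup>2" and z: "z \<in> cball 0 R"
      have "(\<Sum>b\<in>Basis. W (z + e *\<^sub>R b) + W (z - e *\<^sub>R b) - 2 * W z) \<le> e\<^sup>2 * profile_laplacian B A a s z + F * e\<^sup>2"
        using bspec[OF * z] by (simp add: W_def)
      also have "\<dots> \<le> e\<^sup>2 * ((if norm z \<le> r0 then \<theta> else 0) - 2 * F) + F * e\<^sup>2"
        using lap[of z] z by (intro add_right_mono mult_left_mono) auto
      also have "\<dots> = ((if norm z \<le> r0 then \<theta> else 0) - F) * e\<^sup>2" by (simp add: algebra_simps)
      finally show "(\<Sum>b\<in>Basis. W (z + e *\<^sub>R b) + W (z - e *\<^sub>R b) - 2 * W z) \<le> ((if norm z \<le> r0 then \<theta> else 0) - F) * e\<^sup>2" .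
    qed
    show "W z' + h * (2 + norm z / l) < W z" if z': "norm z' \<le> sqrt (real DIM('a)) * l" and z: "norm z \<ge> R" for z z'
    proof -
      define r where "r = norm z"
      have rr: "r \<ge> 2 * (sqrt N * l)" using z by (simp add: r_def R_def)
      have "sqrt N \<ge> 1" using N by simp
      then have "sqrt N * l \<ge> l" using l by simp
      then have r: "r \<ge> 2 * l" "r > 0" using rr l by linarith+
      have z'r: "norm z' \<le> r / 2" using z' rr by (simp add: N_def)
      then have "(norm z')\<^sup>2 \<le> (r / 2)\<^sup>2" by (intro power_mono) auto
      then have sq: "z' \<bullet> z' \<le> r\<^sup>2 / 4" "z \<bullet> z = r\<^sup>2"
        by (simp_all add: power2_norm_eq_inner[symmetric] power_divide r_def)
      have "A * (z \<bullet> z + a) powr (- s) \<le> A * (z' \<bullet> z' + a) powr (- s)"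
      proof -
        have "z' \<bullet> z' \<le> z \<bullet> z" using sq zero_le_power2[of r] by linarith
        then show ?thesis using A a s by (intro mult_left_mono powr_mono2') (auto simp: add_nonneg_pos)
      qed
      moreover have "B * (z' \<bullet> z') \<le> B * r\<^sup>2 / 4" using B sq mult_left_mono[OF sq(1), of B] by simp
      moreover have "h * (2 + r / l) < 3 / 4 * (B * r\<^sup>2)"
      proof -
        have "h * (2 + r / l) \<le> h * (2 * (r / l))" using h r l by (intro mult_left_mono) (auto simp: field_simps)
        also have "\<dots> = (2 * h) * (r / l)" by simp
        also have "\<dots> \<le> (B * l\<^sup>2) * (r / l)" using hl r l by (intro mult_right_mono) auto
        also have "\<dots> = B * (l * r)" using l by (simp add: power2_eq_square)
        also have "\<dots> \<le> B * (r / 2 * r)" using B r by (intro mult_left_mono mult_right_mono) auto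
        also have "\<dots> < 3 / 4 * (B * r\<^sup>2)" using B r by (simp add: power2_eq_square)
        finally show ?thesis .
      qed
      moreover have "b1 - a2 + c < b2 - a1" if "a1 \<le> a2" "b1 \<le> b2 / 4" "c < 3 / 4 * b2" for a1 a2 b1 b2 c :: real
        using that by linarith
      ultimately show ?thesis unfolding W_def profile_def sq(2) r_def[symmetric] by blast
    qed
  qed
qed

section \<open>Gluing the profiles\<close>

lemma obstacle_field_eq_sum:
  assumes "\<And>z. norm z > r1 \<Longrightarrow> \<phi> z = 0" "finite I" "\<And>i. i \<notin> I \<Longrightarrow> norm (X i \<omega>) > norm (x, y) + r1"
  shows "obstacle_field \<phi> X f \<omega> x y = (\<Sum>i\<in>I. f i \<omega> * \<phi> (x - fst (X i \<omega>), y - snd (X i \<omega>)))"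
proof -
  have "\<phi> (x - fst (X i \<omega>), y - snd (X i \<omega>)) = 0" if "i \<notin> I" for i
  proof (rule assms(1))
    have "norm (X i \<omega>) \<le> norm (x, y) + norm ((x, y) - X i \<omega>)"
      using norm_triangle_ineq4[of "(x, y)" "(x, y) - X i \<omega>"] by simp
    moreover have "(x, y) - X i \<omega> = (x - fst (X i \<omega>), y - snd (X i \<omega>))"
      by (simp add: prod_eq_iff)
    ultimately show "r1 < norm (x - fst (X i \<omega>), y - snd (X i \<omega>))" using assms(3)[OF that] by simp
  qed
  then have "obstacle_field \<phi> X f \<omega> x y = (\<Sum>\<^sub>\<infinity>i\<in>I. f i \<omega> * \<phi> (x - fst (X i \<omega>), y - snd (X i \<omega>)))"
    unfolding obstacle_field_def by (intro infsum_cong_neutral) auto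
  then show ?thesis using assms(2) by simp
qed

text \<open>
  Obstacles only ever help: all terms of the field are non-positive, so it is bounded by any
  one of them.
\<close>

lemma obstacle_field_le:
  assumes \<phi>: "\<And>z. norm z > r1 \<Longrightarrow> \<phi> z = 0" "\<And>z. \<phi> z \<le> 0"
    and f: "\<And>i. 0 \<le> f i \<omega>" and lf: "\<And>r. finite {i. norm (X i \<omega>) \<le> r}"
  shows "obstacle_field \<phi> X f \<omega> x y \<le> f i \<omega> * \<phi> (x - fst (X i \<omega>), y - snd (X i \<omega>))"
proof -
  define I where "I = insert i {i. norm (X i \<omega>) \<le> norm (x, y) + r1}"
  have fin: "finite I" using lf by (simp add: I_def)
  have "obstacle_field \<phi> X f \<omega> x y = (\<Sum>i\<in>I. f i \<omega> * \<phi> (x - fst (X i \<omega>), y - snd (X i \<omega>)))"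
    by (rule obstacle_field_eq_sum[OF \<phi>(1) fin]) (auto simp: I_def)
  also have "\<dots> = f i \<omega> * \<phi> (x - fst (X i \<omega>), y - snd (X i \<omega>)) +
      (\<Sum>i\<in>I - {i}. f i \<omega> * \<phi> (x - fst (X i \<omega>), y - snd (X i \<omega>)))"
    using fin by (intro sum.remove) (auto simp: I_def)
  also have "(\<Sum>i\<in>I - {i}. f i \<omega> * \<phi> (x - fst (X i \<omega>), y - snd (X i \<omega>))) \<le> 0"
    using \<phi> f by (intro sum_nonpos mult_nonneg_nonpos) auto
  finally show ?thesis by simp
qed

text \<open>
  Over a compact set the graph of \<open>v\<close> is bounded, so it meets the supports of only finitely many
  obstacles, and the field along it is a finite sum of continuous functions.
\<close>

lemma locally_integrable_obstacle_field:
  fixes v :: "real ^ 'n \<Rightarrow> real"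
  assumes \<phi>: "\<And>z. norm z > r1 \<Longrightarrow> \<phi> z = 0" "continuous_on UNIV \<phi>"
    and lf: "\<And>r. finite {i. norm (X i \<omega>) \<le> r}" and v: "continuous_on UNIV v"
  shows "locally_integrable (\<lambda>x. obstacle_field \<phi> X f \<omega> x (v x))"
  unfolding locally_integrable_def set_integrable_def
proof (intro allI impI)
  fix K :: "(real ^ 'n) set" assume K: "compact K"
  have "compact ((\<lambda>x. (x, v x)) ` K)"
    by (intro compact_continuous_image K continuous_intros continuous_on_subset[OF v]) auto
  then obtain b where b: "\<And>x. x \<in> K \<Longrightarrow> norm (x, v x) \<le> b"
    using compact_imp_bounded bounded_iff by (metis (no_types, lifting) image_eqI)
  define I where "I = {i. norm (X i \<omega>) \<le> b + r1}"
  define S where "S x = (\<Sum>i\<in>I. f i \<omega> * \<phi> (x - fst (X i \<omega>), v x - snd (X i \<omega>)))" for x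
  have eq: "obstacle_field \<phi> X f \<omega> x (v x) = S x" if "x \<in> K" for x
    unfolding S_def using b[OF that] lf
    by (intro obstacle_field_eq_sum[OF \<phi>(1)]) (auto simp: I_def)
  have "continuous_on UNIV S" unfolding S_def
    by (intro continuous_intros continuous_on_compose2[OF \<phi>(2)] v) auto
  then have "integrable lborel (\<lambda>x. indicator K x *\<^sub>R S x)"
    by (intro borel_integrable_compact K continuous_on_subset[of UNIV S K]) auto
  moreover have "(\<lambda>x. indicator K x *\<^sub>R S x) = (\<lambda>x. indicator K x *\<^sub>R obstacle_field \<phi> X f \<omega> x (v x))"
  proof
    show "indicator K x *\<^sub>R S x = indicator K x *\<^sub>R obstacle_field \<phi> X f \<omega> x (v x)" for x
      by (cases "x \<in> K") (simp_all add: eq)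
  qed
  ultimately show "integrable lborel (\<lambda>x. indicator K x *\<^sub>R obstacle_field \<phi> X f \<omega> x (v x))" by simp
qed

lemma norm_le_sqrt_card:
  fixes x :: "real ^ 'n"
  assumes "\<And>i. \<bar>x $ i\<bar> \<le> c"
  shows "norm x \<le> sqrt (real CARD('n)) * c"
proof -
  have "c \<ge> 0" using assms[of undefined] by linarith
  have "norm x = sqrt (\<Sum>i\<in>UNIV. (x $ i)\<^sup>2)" by (simp add: norm_vec_def L2_set_def)
  also have "\<dots> \<le> sqrt (\<Sum>i\<in>(UNIV :: 'n set). c\<^sup>2)"
    using assms by (intro real_sqrt_le_mono sum_mono) (simp add: abs_le_square_iff[symmetric] \<open>c \<ge> 0\<close>)
  also have "\<dots> = sqrt (real CARD('n)) * c" using \<open>c \<ge> 0\<close> by (simp add: real_sqrt_mult)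
  finally show ?thesis .
qed

lemma infnorm_Pair_le:
  fixes x :: "real ^ 'n" and y :: real
  assumes "norm x \<le> c" "\<bar>y\<bar> \<le> c"
  shows "infnorm (x, y) \<le> c"
  unfolding infnorm_Max
proof (rule Max.boundedI)
  fix a assume "a \<in> (\<lambda>i. \<bar>(x, y) \<bullet> i\<bar>) ` Basis"
  then show "a \<le> c" using assms Basis_le_norm[of _ x]
    by (fastforce simp: Basis_prod_def)
qed auto

text \<open>
  Each column \<open>k\<close> contributes the profile \<open>V k\<close> centred at its obstacle \<open>(p k, y k)\<close>. At a point \<open>x\<close>
  of column \<open>\<kappa> x\<close>, a profile centred at distance at least \<open>R\<close> loses against that of the column
  \<open>\<kappa> x\<close>, since the heights are Lipschitz and \<open>W\<close> grows faster. Hence the infimum over the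
  infinitely many columns is a minimum over finitely many, it is attained where the profile is a
  supersolution, and it inherits a modulus of continuity from \<open>W\<close>.
\<close>

lemma pinning_supersolution:
  fixes X :: "nat \<Rightarrow> 'w \<Rightarrow> (real ^ 'n) \<times> real" and W :: "real ^ 'n \<Rightarrow> real"
  assumes shape: "obstacle_shape \<phi> r0 r1"
    and f: "\<And>i. 0 \<le> f i \<omega>" and lf: "\<And>r. finite {i. norm (X i \<omega>) \<le> r}"
    and l: "l > 0" "h > 0" and \<theta>: "\<theta> > 0"
    and Wc: "continuous_on UNIV W" and Wlow: "\<And>z. - r0 \<le> W z"
    and Wcore: "\<And>z. norm z \<le> r0 \<Longrightarrow> \<bar>W z\<bar> \<le> r0"
    and Wsd: "\<forall>\<^sub>F e in at_right 0. \<forall>z\<in>cball 0 R.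
       (\<Sum>b\<in>Basis. W (z + e *\<^sub>R b) + W (z - e *\<^sub>R b) - 2 * W z) \<le> ((if norm z \<le> r0 then \<theta> else 0) - F) * e\<^sup>2"
    and Wgrow: "\<And>z z'. norm z' \<le> sqrt (real CARD('n)) * l \<Longrightarrow> norm z \<ge> R \<Longrightarrow> W z' + h * (2 + norm z / l) < W z"
    and hit: "\<And>k. \<exists>i. X i \<omega> \<in> cell l h r1 (k, H k) \<and> \<theta> \<le> f i \<omega>"
    and lip: "\<And>m k k'. (\<forall>i. \<bar>k $ i - k' $ i\<bar> \<le> int m) \<Longrightarrow> H k \<le> H k' + m"
  shows "\<exists>v. (\<forall>x. 0 \<le> v x) \<and> stationary_supersolution (obstacle_field \<phi> X f \<omega>) F v"
proof -
  have \<phi>: "\<And>z. norm z > r1 \<Longrightarrow> \<phi> z = 0" "\<And>z. \<phi> z \<le> 0" "\<And>z. infnorm z \<le> r0 \<Longrightarrow> \<phi> z \<le> -1"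
    and \<phi>c: "continuous_on UNIV \<phi>"
    and r: "r1 > sqrt (real CARD('n)) * r0" "sqrt (real CARD('n)) * r0 > 0"
    using shape times_cont_diff_continuous unfolding obstacle_shape_def smooth_def by blast+
  have sq1: "sqrt (real CARD('n)) \<ge> 1" by (simp add: Suc_le_eq)
  have r0: "r0 > 0" using r(2) sq1 by (simp add: zero_less_mult_iff)
  have r01: "r0 \<le> r1" using mult_right_mono[OF sq1, of r0] r0 r(1) by linarith
  obtain I where I: "\<And>k. X (I k) \<omega> \<in> cell l h r1 (k, H k)" "\<And>k. \<theta> \<le> f (I k) \<omega>"
    using hit by metis
  define p where "p k = fst (X (I k) \<omega>)" for k
  define y where "y k = snd (X (I k) \<omega>)" for k
  have py: "l * real_of_int (k $ i) < p k $ i" "p k $ i < l * (real_of_int (k $ i) + 1)"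
    "r1 + h * real (H k) < y k" "y k < r1 + h * (real (H k) + 1)" for k i
    using I(1)[of k] cell_iff[of "p k" "y k" l h r1 k "H k"] by (auto simp: p_def y_def)
  define V where "V k x = y k + W (x - p k)" for k x
  define \<kappa> where "\<kappa> x = (\<chi> i. \<lfloor>x $ i / l\<rfloor>)" for x :: "real ^ 'n"
  have \<kappa>: "l * real_of_int (\<kappa> x $ i) \<le> x $ i" "x $ i \<le> l * (real_of_int (\<kappa> x $ i) + 1)" for x i
  proof -
    have "real_of_int \<lfloor>x $ i / l\<rfloor> * l \<le> x $ i" "x $ i \<le> (real_of_int \<lfloor>x $ i / l\<rfloor> + 1) * l"
      using l by (simp_all add: floor_divide_lower floor_divide_upper less_imp_le)
    then show "l * real_of_int (\<kappa> x $ i) \<le> x $ i" "x $ i \<le> l * (real_of_int (\<kappa> x $ i) + 1)"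
      by (simp_all add: \<kappa>_def mult.commute)
  qed
  have own: "norm (x - p (\<kappa> x)) \<le> sqrt (real CARD('n)) * l" for x
  proof (rule norm_le_sqrt_card)
    fix i show "\<bar>(x - p (\<kappa> x)) $ i\<bar> \<le> l"
      using \<kappa>[of x i] py(1,2)[of "\<kappa> x" i] by (simp add: abs_le_iff algebra_simps)
  qed
  have far: "V (\<kappa> x) x < V k x" if far: "norm (x - p k) \<ge> R" for x k
  proof -
    define m where "m = nat \<lfloor>norm (x - p k) / l + 1\<rfloor>"
    have d: "0 \<le> norm (x - p k) / l" using l by simp
    then have m: "real m \<le> norm (x - p k) / l + 1" by (simp add: m_def)
    have im: "int m = \<lfloor>norm (x - p k) / l + 1\<rfloor>"
    proof -
      have "0 \<le> norm (x - p k) / l + 1" using d by linarith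
      then have "0 \<le> \<lfloor>norm (x - p k) / l + 1\<rfloor>" by (simp only: zero_le_floor)
      then show ?thesis unfolding m_def by (rule nat_0_le)
    qed
    have "\<bar>\<kappa> x $ i - k $ i\<bar> \<le> int m" for i
    proof -
      have xi: "\<bar>x $ i - p k $ i\<bar> \<le> norm (x - p k)"
        using component_le_norm_cart[of "x - p k" i] by simp
      have "l * \<bar>real_of_int (\<kappa> x $ i) - real_of_int (k $ i)\<bar> \<le> norm (x - p k) + l"
        using \<kappa>[of x i] py(1,2)[of k i] xi l by (auto simp: abs_if algebra_simps split: if_splits)
      then have "\<bar>real_of_int (\<kappa> x $ i) - real_of_int (k $ i)\<bar> \<le> norm (x - p k) / l + 1"
        using l by (simp add: field_simps)
      then have "\<bar>\<kappa> x $ i - k $ i\<bar> \<le> \<lfloor>norm (x - p k) / l + 1\<rfloor>"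
        unfolding le_floor_iff by simp
      then show ?thesis by (simp only: im)
    qed
    then have "H (\<kappa> x) \<le> H k + m" using lip by blast
    then have "real (H (\<kappa> x)) + 1 \<le> real (H k) + (2 + norm (x - p k) / l)" using m by linarith
    then have "h * (real (H (\<kappa> x)) + 1) \<le> h * (real (H k) + (2 + norm (x - p k) / l))"
      using l by (intro mult_left_mono) auto
    then have "y (\<kappa> x) \<le> y k + h * (2 + norm (x - p k) / l)"
      using py(3)[of k] py(4)[of "\<kappa> x"] by (simp add: algebra_simps)
    then show ?thesis using Wgrow[OF own[of x] far] by (simp add: V_def)
  qed
  have "\<exists>k. norm (x - p k) < R \<and> (\<forall>k'. V k x \<le> V k' x)" for x
  proof -
    define T where "T = {k. norm (x - p k) < R}"
    have "finite T"
    proof -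
      define m where "m = \<lceil>(norm x + R) / l + 1\<rceil>"
      have "T \<subseteq> {k. \<forall>i. \<bar>k $ i\<bar> \<le> m}"
      proof (intro subsetI CollectI allI)
        fix k i assume "k \<in> T"
        then have "\<bar>p k $ i\<bar> \<le> norm x + R"
          using component_le_norm_cart[of "p k" i] norm_triangle_ineq4[of x "x - p k"] by (simp add: T_def)
        then have "l * \<bar>real_of_int (k $ i)\<bar> \<le> norm x + R + l"
          using py(1,2)[of k i] l by (auto simp: abs_if algebra_simps split: if_splits)
        then have "\<bar>real_of_int (k $ i)\<bar> \<le> (norm x + R) / l + 1" using l by (simp add: field_simps)
        also have "\<dots> \<le> real_of_int m" unfolding m_def by (rule le_of_int_ceiling)
        finally show "\<bar>k $ i\<bar> \<le> m" by linarith
      qed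
      then show ?thesis using finite_bounded_lattice by (rule finite_subset)
    qed
    moreover have \<kappa>T: "\<kappa> x \<in> T" using far[of x "\<kappa> x"] by (force simp: T_def not_less)
    ultimately obtain k where k: "k \<in> T" "\<And>k'. k' \<in> T \<Longrightarrow> V k x \<le> V k' x"
      using arg_min_if_finite[of T "\<lambda>k. V k x"] by (metis empty_iff not_le)
    have "V k x \<le> V k' x" for k'
    proof (cases "k' \<in> T")
      case False
      then have "V (\<kappa> x) x < V k' x" by (intro far) (simp add: T_def)
      then show ?thesis using k(2)[OF \<kappa>T] by simp
    qed (use k in auto)
    then show ?thesis using k(1) by (auto simp: T_def)
  qed
  then obtain J where J: "\<And>x. norm (x - p (J x)) < R" "\<And>x k. V (J x) x \<le> V k x" by metis
  \<comment> \<open>\<open>J x\<close> is the column whose profile attains the minimum at \<open>x\<close>.\<close>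
  define v where "v x = V (J x) x" for x
  have vc: "continuous_on UNIV v"
    unfolding continuous_on_iff
  proof (intro ballI allI impI)
    fix x and e :: real assume "e > 0"
    have "uniformly_continuous_on (cball 0 (R + 1)) W"
      by (intro compact_uniformly_continuous continuous_on_subset[OF Wc]) auto
    then obtain d where d: "d > 0" and
      u: "\<And>z z'. z \<in> cball 0 (R + 1) \<Longrightarrow> z' \<in> cball 0 (R + 1) \<Longrightarrow> dist z' z < d \<Longrightarrow> dist (W z') (W z) < e"
      unfolding uniformly_continuous_on_def using \<open>e > 0\<close> by metis
    have half: "v b < v a + e" if ab: "dist a b < min d 1" for a b
    proof -
      have 1: "a - p (J a) \<in> cball 0 (R + 1)" using J(1)[of a] by simp
      have 2: "b - p (J a) \<in> cball 0 (R + 1)"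
        using J(1)[of a] ab norm_triangle_ineq[of "b - a" "a - p (J a)"] by (simp add: dist_norm norm_minus_commute)
      have "dist (b - p (J a)) (a - p (J a)) < d" using ab by (simp add: dist_norm norm_minus_commute)
      then have "W (b - p (J a)) < W (a - p (J a)) + e" using u[OF 1 2] by (simp add: dist_real_def)
      then have "V (J a) b < V (J a) a + e" by (simp add: V_def)
      then show ?thesis using J(2)[of b "J a"] by (simp add: v_def)
    qed
    show "\<exists>d>0. \<forall>x'\<in>UNIV. dist x' x < d \<longrightarrow> dist (v x') (v x) < e"
    proof (intro exI[of _ "min d 1"] conjI ballI impI)
      show "min d 1 > 0" using d by simp
      fix x' assume a: "dist x' x < min d 1"
      then show "dist (v x') (v x) < e" using half[of x' x] half[of x x']
        by (simp add: dist_real_def dist_commute abs_less_iff)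
    qed
  qed
  have gle: "obstacle_field \<phi> X f \<omega> x (v x) \<le> - (if norm (x - p (J x)) \<le> r0 then \<theta> else 0)" for x
  proof -
    have le: "obstacle_field \<phi> X f \<omega> x (v x) \<le> f (I (J x)) \<omega> * \<phi> (x - p (J x), v x - y (J x))"
      unfolding p_def y_def by (rule obstacle_field_le[where f=f and X=X and \<omega>=\<omega>, OF \<phi>(1,2) f lf])
    show ?thesis
    proof (cases "norm (x - p (J x)) \<le> r0")
      case True
      have "v x - y (J x) = W (x - p (J x))" by (simp add: v_def V_def)
      then have "\<phi> (x - p (J x), v x - y (J x)) \<le> -1"
        using Wcore[OF True] True by (intro \<phi>(3) infnorm_Pair_le) auto
      then have "f (I (J x)) \<omega> * \<phi> (x - p (J x), v x - y (J x)) \<le> f (I (J x)) \<omega> * (-1)"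
        using f by (intro mult_left_mono) auto
      then show ?thesis using le I(2)[of "J x"] True by simp
    next
      case False
      have "f (I (J x)) \<omega> * \<phi> (x - p (J x), v x - y (J x)) \<le> 0" using f \<phi>(2) by (intro mult_nonneg_nonpos) auto
      then show ?thesis using le False by simp
    qed
  qed
  have sd: "\<forall>\<^sub>F e in at_right 0. \<forall>x. (\<Sum>b\<in>Basis. v (x + e *\<^sub>R b) + v (x - e *\<^sub>R b) - 2 * v x)
     \<le> - (obstacle_field \<phi> X f \<omega> x (v x) + F) * e\<^sup>2"
    using Wsd
  proof (rule eventually_mono, intro allI)
    fix e :: real and x
    assume *: "\<forall>z\<in>cball 0 R. (\<Sum>b\<in>Basis. W (z + e *\<^sub>R b) + W (z - e *\<^sub>R b) - 2 * W z)
      \<le> ((if norm z \<le> r0 then \<theta> else 0) - F) * e\<^sup>2"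
    define z where "z = x - p (J x)"
    have z: "z \<in> cball 0 R" using J(1)[of x] by (simp add: z_def)
    have "(\<Sum>b\<in>Basis. v (x + e *\<^sub>R b) + v (x - e *\<^sub>R b) - 2 * v x)
      \<le> (\<Sum>b\<in>Basis. V (J x) (x + e *\<^sub>R b) + V (J x) (x - e *\<^sub>R b) - 2 * V (J x) x)"
      using J(2) unfolding v_def by (intro sum_mono diff_right_mono add_mono) auto
    also have "\<dots> = (\<Sum>b\<in>Basis. W (z + e *\<^sub>R b) + W (z - e *\<^sub>R b) - 2 * W z)"
      unfolding V_def z_def by (intro sum.cong refl) (simp add: algebra_simps)
    also have "\<dots> \<le> ((if norm z \<le> r0 then \<theta> else 0) - F) * e\<^sup>2" using * z by blast
    also have "\<dots> \<le> - (obstacle_field \<phi> X f \<omega> x (v x) + F) * e\<^sup>2"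
      using gle[of x] by (intro mult_right_mono) (auto simp: z_def)
    finally show "(\<Sum>b\<in>Basis. v (x + e *\<^sub>R b) + v (x - e *\<^sub>R b) - 2 * v x)
      \<le> - (obstacle_field \<phi> X f \<omega> x (v x) + F) * e\<^sup>2" .
  qed
  have "0 \<le> v x" for x
  proof -
    have "0 \<le> h * real (H (J x))" using l by simp
    then show ?thesis using py(3)[of "J x"] Wlow[of "x - p (J x)"] r01 by (simp add: v_def V_def)
  qed
  moreover have "stationary_supersolution (obstacle_field \<phi> X f \<omega>) F v"
    unfolding stationary_supersolution_def
    using second_difference_imp_viscosity[where g="obstacle_field \<phi> X f \<omega>" and F=F, OF vc sd]
      second_difference_imp_distributional[where g="obstacle_field \<phi> X f \<omega>" and F=F, OF vc locally_integrable_obstacle_field[where f=f and X=X and \<omega>=\<omega>, OF \<phi>(1) \<phi>c lf vc] sd] by blast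
  ultimately show ?thesis by blast
qed

section \<open>Pinning\<close>

theorem theorem2p4:
  fixes M :: "'w measure"
    and \<phi> :: "(real ^ 'n) \<times> real \<Rightarrow> real"
    and r0 r1 lam :: real
    and X :: "nat \<Rightarrow> 'w \<Rightarrow> (real ^ 'n) \<times> real"
    and f :: "nat \<Rightarrow> 'w \<Rightarrow> real"
  assumes "prob_space M"
    and "obstacle_shape \<phi> r0 r1"
    and "obstacle_distribution M lam r1 X f"
  shows "\<exists>Fstar > 0. \<exists>v :: real ^ 'n \<Rightarrow> 'w \<Rightarrow> real.
      (\<forall>x. \<forall>\<omega>\<in>space M. 0 \<le> v x \<omega>) \<and>
      (AE \<omega> in M.
         stationary_supersolution (obstacle_field \<phi> X f \<omega>) Fstar (\<lambda>x. v x \<omega>) \<and>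
         (\<forall>F \<le> Fstar. \<forall>U. comparison_class (obstacle_field \<phi> X f \<omega>) F U \<longrightarrow>
            (\<forall>u\<in>U. evolution_solution (obstacle_field \<phi> X f \<omega>) F u \<and> (\<forall>x. u x 0 = 0) \<longrightarrow>
               (\<forall>x. \<forall>t\<ge>0. u x t \<le> v x \<omega>))))"
proof -
  interpret prob_space M by fact
  note shape = assms(2) and od = assms(3)
  have lam: "lam > 0" and X: "poisson_process M lam (UNIV \<times> {r1..}) X"
    and fpos: "\<forall>k. \<forall>\<omega>\<in>space M. 0 \<le> f k \<omega>" and f0: "AE \<omega> in M. 0 < f 0 \<omega>"
    and fm: "f 0 \<in> borel_measurable M"
    using od by (auto simp: obstacle_distribution_def indep_vars_def)
  obtain \<theta> where \<theta>: "\<theta> > 0" "prob {\<omega> \<in> space M. f 0 \<omega> < \<theta>} \<le> 1 / 2"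
    using exists_strength_threshold[OF fm f0] by blast
  have r0: "r0 > 0" using shape by (auto simp: obstacle_shape_def zero_less_mult_iff)
  define E where "E = real (card {e :: int ^ 'n. \<forall>i. \<bar>e $ i\<bar> \<le> 1})"
  \<comment> \<open>The cell volume that makes the percolation estimate applicable, where \<open>E\<close> is the number of
    sideways moves.\<close>
  define V where "V = 2 / lam * ln ((2 * (E + 1))\<^sup>2)"
  have E: "(2 * (E + 1))\<^sup>2 > 1" by (auto intro!: one_less_power simp: E_def)
  have V: "V > 0" unfolding V_def by (intro mult_pos_pos divide_pos_pos ln_gt_zero E lam) auto
  have q: "(2 * (E + 1))\<^sup>2 * exp (- (lam * V / 2)) \<le> 1"
  proof -
    have "lam * V / 2 = ln ((2 * (E + 1))\<^sup>2)" using lam by (simp add: V_def)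
    then have "exp (- (lam * V / 2)) = inverse ((2 * (E + 1))\<^sup>2)"
      using E by (simp only: exp_minus exp_ln)
    moreover have "t * inverse t \<le> 1" for t :: real by (cases "t = 0") auto
    ultimately show ?thesis by (simp only:)
  qed
  have dim: "DIM(real ^ 'n) = CARD('n)" by simp
  obtain l h R F and W :: "real ^ 'n \<Rightarrow> real" where l: "l > 0" "h > 0" "l ^ CARD('n) * h = V" and F: "F > 0"
    and W: "continuous_on UNIV W" "\<And>z. - r0 \<le> W z" "\<And>z. norm z \<le> r0 \<Longrightarrow> \<bar>W z\<bar> \<le> r0"
    "\<forall>\<^sub>F e in at_right 0. \<forall>z\<in>cball 0 R.
       (\<Sum>b\<in>Basis. W (z + e *\<^sub>R b) + W (z - e *\<^sub>R b) - 2 * W z) \<le> ((if norm z \<le> r0 then \<theta> else 0) - F) * e\<^sup>2"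
    "\<And>z z'. norm z' \<le> sqrt (real CARD('n)) * l \<Longrightarrow> norm z \<ge> R \<Longrightarrow> W z' + h * (2 + norm z / l) < W z"
    by (rule exists_obstacle_profile[OF \<theta>(1) r0 V, where 'a="real ^ 'n", unfolded dim]) blast
  have AE_super: "AE \<omega> in M. \<exists>w. (\<forall>x. 0 \<le> w x) \<and> stationary_supersolution (obstacle_field \<phi> X f \<omega>) F w"
    using AE_obstacle_surface[OF od \<theta>(2) l(1,2), unfolded l(3), folded E_def, OF q] AE_locally_finite[OF X] AE_space
  proof eventually_elim
    case (elim \<omega>)
    then obtain H where H: "\<And>k. \<exists>i. X i \<omega> \<in> cell l h r1 (k, H k) \<and> \<theta> \<le> f i \<omega>"
      "\<And>m k k'. (\<forall>i. \<bar>k $ i - k' $ i\<bar> \<le> int m) \<Longrightarrow> H k \<le> H k' + m" by blast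
    show ?case
    proof (rule pinning_supersolution[where X=X and f=f and \<omega>=\<omega> and W=W and H=H, OF shape _ _ l(1,2) \<theta>(1) W H])
      show "0 \<le> f i \<omega>" for i using fpos elim by blast
      show "finite {i. norm (X i \<omega>) \<le> r}" for r using elim by blast
    qed
  qed
  define Good where "Good \<omega> w \<longleftrightarrow> (\<forall>x. 0 \<le> w x) \<and> stationary_supersolution (obstacle_field \<phi> X f \<omega>) F w"
    for \<omega> and w :: "real ^ 'n \<Rightarrow> real"
  \<comment> \<open>The supersolutions for almost every \<open>\<omega>\<close> are collected into one function by choice; on the
    exceptional set the value 0 keeps it non-negative.\<close>
  define v where "v x \<omega> = (if \<exists>w. Good \<omega> w then (SOME w. Good \<omega> w) x else 0)" for x \<omega>
  have good: "Good \<omega> (\<lambda>x. v x \<omega>)" if "\<exists>w. Good \<omega> w" for \<omega>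
    using someI_ex[OF that] that by (simp add: v_def)
  show ?thesis
  proof (intro exI[of _ F] exI[of _ v] conjI F allI ballI)
    show "0 \<le> v x \<omega>" for x \<omega>
      using good[of \<omega>] by (cases "\<exists>w. Good \<omega> w") (auto simp: Good_def v_def)
    show "AE \<omega> in M.
         stationary_supersolution (obstacle_field \<phi> X f \<omega>) F (\<lambda>x. v x \<omega>) \<and>
         (\<forall>F' \<le> F. \<forall>U. comparison_class (obstacle_field \<phi> X f \<omega>) F' U \<longrightarrow>
            (\<forall>u\<in>U. evolution_solution (obstacle_field \<phi> X f \<omega>) F' u \<and> (\<forall>x. u x 0 = 0) \<longrightarrow>
               (\<forall>x. \<forall>t\<ge>0. u x t \<le> v x \<omega>)))"
      using AE_super
    proof eventually_elim
      case (elim \<omega>)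
      then have g: "Good \<omega> (\<lambda>x. v x \<omega>)" by (intro good) (simp add: Good_def)
      then have ss: "stationary_supersolution (obstacle_field \<phi> X f \<omega>) F (\<lambda>x. v x \<omega>)" and pos: "\<forall>x. 0 \<le> v x \<omega>"
        by (simp_all add: Good_def)
      have "u x t \<le> v x \<omega>" if "F' \<le> F" "comparison_class (obstacle_field \<phi> X f \<omega>) F' U" "u \<in> U"
        "evolution_solution (obstacle_field \<phi> X f \<omega>) F' u" "\<forall>x. u x 0 = 0" "t \<ge> 0" for F' U u x t
      proof -
        have "stationary_supersolution (obstacle_field \<phi> X f \<omega>) F' (\<lambda>x. v x \<omega>)"
          by (rule stationary_supersolution_antimono[OF ss that(1)])
        moreover have "\<forall>x. u x 0 \<le> v x \<omega>" using that(5) pos by simp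
        ultimately show ?thesis using that(2,3,4,6) unfolding comparison_class_def by blast
      qed
      then show ?case using ss by blast
    qed
  qed
qed

end
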